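(* Let $A=KQ/I$ be an almost gentle algebra with set of maximal paths $\mathcal M$ and let $A^*$ be the symmetric special multiserial algebra associated to $A$. Then \[\dim_K(A^* )=2|Q_0|+\sum_{m\in\mathcal M}\ell(m)\cdot(\ell(m)+1),\] where $\ell(m)$ is the length of the path $m$. In particular, $\dim_K(A^* )=2\dim_K(A)$.
   Context: $K$ is a field; all algebras are indecomposable and finite dimensional over $K$. Quivers are finite, $Q_0$ and $Q_1$ denote vertices and arrows; $ab$ denotes the arrow $a$ followed by the arrow $b$ (and is $0$ if not composable). For a presentation $KQ/I$ the ideal $I$ is admissible. An algebra is almost gentle if it is Morita equivalent to some $KQ/I$ such that (S0) $I$ is generated by paths of length 2, and (S1) for every $a\in Q_1$ there is at most one arrow $b$ with $ab\notin I$ and at most one arrow $c$ with $ca\notin I$. "Let $A=KQ/I$ be almost gentle" means that the presentation satisfies (S0) and (S1). A path $p$ in $Q$ is a maximal path of $A$ if $p\notin I$ and $ap\in I$ and $pa\in I$ for every $a\in Q_1$. Definition of $A^*$: the quiver $Q^*$ has the same vertices as $Q$, and its arrows are those of $Q$ together with, for each $m\in\mathcal M$, a new arrow $a_m$ from the end vertex of $m$ to the start vertex of $m$. Put $C_m=ma_m$, and let $\mathcal S$ be the set of all cyclic permutations of the cycles $C_m$, $m\in\mathcal M$. The ideal $I^*$ of $KQ^*$ is generated by: Type 1: $C-C'$ for $C,C'\in\mathcal S$ cycles at the same vertex; Type 2: $Ca$ for $C\in\mathcal S$ with first arrow $a$; Type 3: $ab$ for arrows $a,b$ of $Q^*$ such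 that $ab$ is not a subpath of any $C\in\mathcal S$. Then $A^*=KQ^*/I^*$. *)

theory Defs
  imports
    "Graph_Theory.Arc_Walk"
    "HOL-Algebra.Embedded_Algebras"
    "HOL-Algebra.Ideal_Product"
    "HOL-Algebra.QuotRing"
    "HOL-Library.Poly_Mapping"
    "HOL-Library.Sublist"
begin

section \<open>Path algebras\<close>

text \<open>A quiver is a directed multigraph (finite ones: \<^locale>\<open>fin_digraph\<close>); \<open>tail\<close> and \<open>head\<close>
  give the start and the end vertex of an arrow. A path is its start vertex together with its list
  of arrows, in the order in which they are traversed; \<open>(v, [])\<close> is the trivial path at \<open>v\<close>.\<close>

type_synonym ('v, 'a) qpath = "'v \<times> 'a list"

definition paths :: "('v, 'a) pre_digraph \<Rightarrow> ('v, 'a) qpath set" where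
  "paths Q = {(u, p). \<exists>v. pre_digraph.awalk Q u p v}"

definition path_end :: "('v, 'a) pre_digraph \<Rightarrow> ('v, 'a) qpath \<Rightarrow> 'v" where
  "path_end Q p = last (pre_digraph.awalk_verts Q (fst p) (snd p))"

abbreviation path_length :: "('v, 'a) qpath \<Rightarrow> nat" where
  "path_length p \<equiv> length (snd p)"

abbreviation path_elem :: "('v, 'a) qpath \<Rightarrow> (('v, 'a) qpath \<Rightarrow>\<^sub>0 'k::field)" where
  "path_elem p \<equiv> Poly_Mapping.single p 1"

abbreviation arrow_elem :: "('v, 'a) pre_digraph \<Rightarrow> 'a \<Rightarrow> (('v, 'a) qpath \<Rightarrow>\<^sub>0 'k::field)" where
  "arrow_elem Q a \<equiv> path_elem (tail Q a, [a])"

definition path_mult :: "('v, 'a) pre_digraph \<Rightarrow> (('v, 'a) qpath \<Rightarrow>\<^sub>0 'k::field) \<Rightarrow>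
    (('v, 'a) qpath \<Rightarrow>\<^sub>0 'k) \<Rightarrow> (('v, 'a) qpath \<Rightarrow>\<^sub>0 'k)" where
  "path_mult Q f g =
     (\<Sum>p\<in>Poly_Mapping.keys f. \<Sum>q\<in>Poly_Mapping.keys g.
        if path_end Q p = fst q
        then Poly_Mapping.single (fst p, snd p @ snd q)
               (Poly_Mapping.lookup f p * Poly_Mapping.lookup g q)
        else 0)"

text \<open>The scalar multiple \<open>c \<cdot> 1\<close> of the identity.\<close>

definition scalar :: "('v, 'a) pre_digraph \<Rightarrow> 'k::field \<Rightarrow> (('v, 'a) qpath \<Rightarrow>\<^sub>0 'k)" where
  "scalar Q c = (\<Sum>v\<in>verts Q. Poly_Mapping.single (v, []) c)"

definition path_algebra :: "('v, 'a) pre_digraph \<Rightarrow> (('v, 'a) qpath \<Rightarrow>\<^sub>0 'k::field) ring" where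
  "path_algebra Q =
     \<lparr>carrier = {f. Poly_Mapping.keys f \<subseteq> paths Q}, monoid.mult = path_mult Q, one = scalar Q 1,
      zero = 0, add = (+)\<rparr>"

section \<open>Quotients of path algebras\<close>

definition quot_algebra :: "('v, 'a) pre_digraph \<Rightarrow> (('v, 'a) qpath \<Rightarrow>\<^sub>0 'k::field) set \<Rightarrow>
    (('v, 'a) qpath \<Rightarrow>\<^sub>0 'k) set ring" where
  "quot_algebra Q I = path_algebra Q Quot I"

text \<open>The copy of \<open>K\<close> inside \<open>KQ/I\<close>, a subfield as soon as \<open>KQ/I\<close> is nonzero. The vector space
  structure of \<open>KQ/I\<close> is multiplication by elements of this subfield.\<close>

definition quot_scalars :: "('v, 'a) pre_digraph \<Rightarrow> (('v, 'a) qpath \<Rightarrow>\<^sub>0 'k::field) set \<Rightarrow>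
    (('v, 'a) qpath \<Rightarrow>\<^sub>0 'k) set set" where
  "quot_scalars Q I = range (\<lambda>c. I +>\<^bsub>path_algebra Q\<^esub> scalar Q c)"

definition quot_finite_dim :: "('v, 'a) pre_digraph \<Rightarrow> (('v, 'a) qpath \<Rightarrow>\<^sub>0 'k::field) set \<Rightarrow> bool"
  where
  "quot_finite_dim Q I \<longleftrightarrow>
     ring.finite_dimension (quot_algebra Q I) (quot_scalars Q I) (carrier (quot_algebra Q I))"

definition quot_dim :: "('v, 'a) pre_digraph \<Rightarrow> (('v, 'a) qpath \<Rightarrow>\<^sub>0 'k::field) set \<Rightarrow> nat" where
  "quot_dim Q I =
     ring.dim (quot_algebra Q I) (quot_scalars Q I) (carrier (quot_algebra Q I))"

definition indecomposable_ring :: "('r, 'm) ring_scheme \<Rightarrow> bool" where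
  "indecomposable_ring R \<longleftrightarrow>
     carrier R \<noteq> {\<zero>\<^bsub>R\<^esub>} \<and>
     (\<forall>B C. ideal B R \<longrightarrow> ideal C R \<longrightarrow> B \<inter> C = {\<zero>\<^bsub>R\<^esub>} \<longrightarrow> B <+>\<^bsub>R\<^esub> C = carrier R \<longrightarrow>
        B = {\<zero>\<^bsub>R\<^esub>} \<or> C = {\<zero>\<^bsub>R\<^esub>})"

definition arrow_ideal :: "('v, 'a) pre_digraph \<Rightarrow> (('v, 'a) qpath \<Rightarrow>\<^sub>0 'k::field) set" where
  "arrow_ideal Q = Idl\<^bsub>path_algebra Q\<^esub> (arrow_elem Q ` arcs Q)"

primrec arrow_ideal_pow ::
    "('v, 'a) pre_digraph \<Rightarrow> nat \<Rightarrow> (('v, 'a) qpath \<Rightarrow>\<^sub>0 'k::field) set" where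
  "arrow_ideal_pow Q 0 = carrier (path_algebra Q)"
| "arrow_ideal_pow Q (Suc n) = arrow_ideal_pow Q n \<cdot>\<^bsub>path_algebra Q\<^esub> arrow_ideal Q"

definition admissible :: "('v, 'a) pre_digraph \<Rightarrow> (('v, 'a) qpath \<Rightarrow>\<^sub>0 'k::field) set \<Rightarrow> bool" where
  "admissible Q I \<longleftrightarrow>
     ideal I (path_algebra Q) \<and> I \<subseteq> arrow_ideal_pow Q 2 \<and> (\<exists>n\<ge>2. arrow_ideal_pow Q n \<subseteq> I)"

section \<open>Almost gentle algebras and their symmetric special multiserial algebras\<close>

definition almost_gentle :: "('v, 'a) pre_digraph \<Rightarrow> (('v, 'a) qpath \<Rightarrow>\<^sub>0 'k::field) set \<Rightarrow> bool"
  where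
  "almost_gentle Q I \<longleftrightarrow>
     fin_digraph Q \<and> admissible Q I \<and>
     (\<exists>P \<subseteq> {p \<in> paths Q. path_length p = 2}. I = Idl\<^bsub>path_algebra Q\<^esub> (path_elem ` P)) \<and>
     (\<forall>a\<in>arcs Q.
        (\<exists>\<^sub>\<le>\<^sub>1 b. b \<in> arcs Q \<and> arrow_elem Q a \<otimes>\<^bsub>path_algebra Q\<^esub> arrow_elem Q b \<notin> I) \<and>
        (\<exists>\<^sub>\<le>\<^sub>1 c. c \<in> arcs Q \<and> arrow_elem Q c \<otimes>\<^bsub>path_algebra Q\<^esub> arrow_elem Q a \<notin> I))"

text \<open>Trivial paths are allowed: the trivial path at \<open>v\<close> is maximal iff no arrow starts or ends
  at \<open>v\<close>, so for indecomposable \<open>KQ/I\<close> this occurs exactly when \<open>Q\<close> is a single vertex.\<close>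

definition maximal_paths :: "('v, 'a) pre_digraph \<Rightarrow> (('v, 'a) qpath \<Rightarrow>\<^sub>0 'k::field) set \<Rightarrow>
    ('v, 'a) qpath set" where
  "maximal_paths Q I =
     {p \<in> paths Q. path_elem p \<notin> I \<and>
        (\<forall>a\<in>arcs Q. arrow_elem Q a \<otimes>\<^bsub>path_algebra Q\<^esub> path_elem p \<in> I \<and>
                    path_elem p \<otimes>\<^bsub>path_algebra Q\<^esub> arrow_elem Q a \<in> I)}"

text \<open>The arrows of \<open>Q\<^sup>*\<close> are the old arrows \<open>Inl a\<close> and the new arrows \<open>Inr m\<close>, the latter
  standing for \<open>a\<^sub>m\<close>.\<close>

definition star_quiver :: "('v, 'a) pre_digraph \<Rightarrow> (('v, 'a) qpath \<Rightarrow>\<^sub>0 'k::field) set \<Rightarrow>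
    ('v, 'a + ('v, 'a) qpath) pre_digraph" where
  "star_quiver Q I =
     \<lparr>verts = verts Q, arcs = Inl ` arcs Q \<union> Inr ` maximal_paths Q I,
      tail = case_sum (tail Q) (path_end Q), head = case_sum (head Q) fst\<rparr>"

definition closing_cycle :: "('v, 'a) qpath \<Rightarrow> ('v, 'a + ('v, 'a) qpath) qpath" where
  "closing_cycle m = (fst m, map Inl (snd m) @ [Inr m])"

definition cyclic_permutations :: "('v, 'a) pre_digraph \<Rightarrow> ('v, 'a) qpath \<Rightarrow> ('v, 'a) qpath set" where
  "cyclic_permutations Q c = {(tail Q (hd (rotate k (snd c))), rotate k (snd c)) | k. True}"

definition star_cycles :: "('v, 'a) pre_digraph \<Rightarrow> (('v, 'a) qpath \<Rightarrow>\<^sub>0 'k::field) set \<Rightarrow>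
    ('v, 'a + ('v, 'a) qpath) qpath set" where
  "star_cycles Q I =
     (\<Union>m\<in>maximal_paths Q I. cyclic_permutations (star_quiver Q I) (closing_cycle m))"

text \<open>The three sets are the relations of type 1, 2 and 3.\<close>

definition star_relations :: "('v, 'a) pre_digraph \<Rightarrow> (('v, 'a) qpath \<Rightarrow>\<^sub>0 'k::field) set \<Rightarrow>
    (('v, 'a + ('v, 'a) qpath) qpath \<Rightarrow>\<^sub>0 'k) set" where
  "star_relations Q I =
     {path_elem C - path_elem C' | C C'.
        C \<in> star_cycles Q I \<and> C' \<in> star_cycles Q I \<and> fst C = fst C'} \<union>
     {path_elem C \<otimes>\<^bsub>path_algebra (star_quiver Q I)\<^esub> arrow_elem (star_quiver Q I) (hd (snd C)) | C.
        C \<in> star_cycles Q I} \<union>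
     {arrow_elem (star_quiver Q I) a \<otimes>\<^bsub>path_algebra (star_quiver Q I)\<^esub>
        arrow_elem (star_quiver Q I) b | a b.
        a \<in> arcs (star_quiver Q I) \<and> b \<in> arcs (star_quiver Q I) \<and>
        \<not> (\<exists>C\<in>star_cycles Q I. sublist [a, b] (snd C))}"

definition star_ideal :: "('v, 'a) pre_digraph \<Rightarrow> (('v, 'a) qpath \<Rightarrow>\<^sub>0 'k::field) set \<Rightarrow>
    (('v, 'a + ('v, 'a) qpath) qpath \<Rightarrow>\<^sub>0 'k) set" where
  "star_ideal Q I = Idl\<^bsub>path_algebra (star_quiver Q I)\<^esub> star_relations Q I"

end

theory Submission
  imports Defs
begin

text \<open>
  Both algebras have a basis of paths. Give a quiver a partial map on paths that sends every path
  either to zero or to a normal form, compatibly with composition; the linear combinations of paths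
  that this map sends to zero form an ideal, and the normal forms are a basis of the quotient.

  For \<open>A\<close> every path is normal or zero. A nonzero nontrivial path is a contiguous piece of exactly
  one maximal path, at exactly one position, so there are \<open>\<ell>(m) (\<ell>(m) + 1) / 2\<close> of them for
  each \<open>m\<close>.

  In \<open>Q\<^sup>*\<close> every arrow lies on exactly one cycle \<open>C\<^sub>m\<close>, hence has a unique successor. A path is
  nonzero iff each of its arrows is followed by the successor and its length does not exceed that
  of the cycle; all full cycles at one vertex are identified. Each arrow of \<open>C\<^sub>m\<close> starts \<open>\<ell>(m)\<close>
  proper nontrivial pieces, and each vertex contributes its trivial path and one full cycle.
\<close>

section \<open>Path algebras\<close>

text \<open>The delicate half of a basis claim is independence modulo a generated ideal. It comes
  from the linear extension of the normal form map, which is a projection: once it respects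
  composition on either side, its kernel is a two-sided ideal, and no nonzero combination of normal
  forms lies in that kernel. The generated ideal is then squeezed: its generators lie in the kernel,
  and every path is congruent to its normal form modulo the generators. Condition (S1) alone lets
  nonzero composition arrange the arrows in strings and cycles. Admissibility excludes the cycles,
  because some power of the arrow ideal lies in \<open>I\<close>; hence every arrow lies on a
  maximal path, and each new arrow closes one string to a cycle. An isolated vertex fits in through
  its trivial maximal path: the closing cycle is a loop of length 1 with square zero, it adds 0 to
  the sum, and it serves as the full cycle at that vertex. Indecomposability enters through the
  existence of a vertex, which makes both quotients nonzero.\<close>

lemma poly_mapping_induct_on [consumes 1, case_names zero plus]:
  fixes f :: "'b \<Rightarrow>\<^sub>0 'k::comm_monoid_add"
  assumes "Poly_Mapping.keys f \<subseteq> A" and "P 0"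
    and step: "\<And>p c f. \<lbrakk>p \<in> A; Poly_Mapping.keys f \<subseteq> A; P f\<rbrakk> \<Longrightarrow> P (Poly_Mapping.single p c + f)"
  shows "P f"
  using assms(1)
proof (induction f rule: update_induct)
  case const
  show ?case by (fact \<open>P 0\<close>)
next
  case (update f p c)
  \<comment> \<open>\<open>p\<close> is new to the support of \<open>f\<close>, so overwriting its
    coefficient amounts to adding a monomial.\<close>
  have eq: "Poly_Mapping.update p c f = Poly_Mapping.single p c + f"
    using update(1)
    by (intro poly_mapping_eqI)
      (auto simp: lookup_update lookup_add lookup_single when_def not_in_keys_iff_lookup_eq_zero)
  have "Poly_Mapping.keys (Poly_Mapping.update p c f) = insert p (Poly_Mapping.keys f)"
    using update(2) by (simp add: keys_update)
  then have sub: "p \<in> A" "Poly_Mapping.keys f \<subseteq> A"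
    using update(4) by simp_all
  show ?case
    unfolding eq by (rule step [OF sub update(3) [OF sub(2)]])
qed

lemma path_end_conv: "path_end Q (u, p) = (if p = [] then u else head Q (last p))"
  by (simp add: path_end_def pre_digraph.awalk_verts_conv)

text \<open>Names the summand of \<open>path_mult\<close>: vanishing at coefficient 0 and additivity
  in the coefficient are what \<open>setsum_keys_plus_distrib\<close> asks for, which copes with the
  changing supports in a sum.\<close>

definition comp_term :: "('v, 'a) pre_digraph \<Rightarrow> ('v, 'a) qpath \<Rightarrow> ('v, 'a) qpath \<Rightarrow> 'k::field \<Rightarrow>
    (('v, 'a) qpath \<Rightarrow>\<^sub>0 'k)" where
  "comp_term Q p q c =
     (if path_end Q p = fst q then Poly_Mapping.single (fst p, snd p @ snd q) c else 0)"

lemma comp_term_zero [simp]: "comp_term Q p q 0 = 0"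
  by (simp add: comp_term_def)

lemma comp_term_add: "comp_term Q p q (c + d) = comp_term Q p q c + comp_term Q p q d"
  by (simp add: comp_term_def single_add)

lemma path_mult_alt:
  "path_mult Q f g = (\<Sum>p\<in>Poly_Mapping.keys f. \<Sum>q\<in>Poly_Mapping.keys g.
     comp_term Q p q (Poly_Mapping.lookup f p * Poly_Mapping.lookup g q))"
  by (simp add: path_mult_def comp_term_def)

lemma path_mult_zero [simp]: "path_mult Q 0 g = 0" "path_mult Q f 0 = 0"
  by (simp_all add: path_mult_def)

lemma path_mult_add_left: "path_mult Q (f + f') g = path_mult Q f g + path_mult Q f' g"
  unfolding path_mult_alt
  by (rule setsum_keys_plus_distrib) (simp_all add: algebra_simps comp_term_add sum.distrib)

lemma path_mult_add_right: "path_mult Q f (g + g') = path_mult Q f g + path_mult Q f g'"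
  unfolding path_mult_alt sum.distrib [symmetric]
  by (rule sum.cong [OF refl], rule setsum_keys_plus_distrib)
    (simp_all add: algebra_simps comp_term_add sum.distrib)

lemma path_mult_single:
  "path_mult Q (Poly_Mapping.single p c) (Poly_Mapping.single q d) = comp_term Q p q (c * d)"
  by (simp add: path_mult_alt)

lemma path_mult_minus:
  "path_mult Q (- f) g = - path_mult Q f g" "path_mult Q f (- g) = - path_mult Q f g"
  using path_mult_add_left[of Q f "- f" g] path_mult_add_right[of Q f g "- g"]
  by (simp_all add: eq_neg_iff_add_eq_0 add.commute)

lemma path_mult_diff:
  "path_mult Q (f - f') g = path_mult Q f g - path_mult Q f' g"
  "path_mult Q f (g - g') = path_mult Q f g - path_mult Q f g'"
  using path_mult_add_left[of Q f "- f'" g] path_mult_add_right[of Q f g "- g'"]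
  by (simp_all add: path_mult_minus)

lemma path_end_append: "path_end Q (u, p @ q) = path_end Q (path_end Q (u, p), q)"
  by (simp add: path_end_conv)

text \<open>By additivity in each argument everything reduces to three single paths. There both
  bracketings test the same two meeting points, because appending a composable path moves the end to
  the end of the appended path.\<close>

lemma path_mult_assoc:
  fixes f g h :: "('v, 'a) qpath \<Rightarrow>\<^sub>0 'k::field"
  shows "path_mult Q (path_mult Q f g) h = path_mult Q f (path_mult Q g h)"
proof -
  have single: "path_mult Q (path_mult Q (Poly_Mapping.single p c) (Poly_Mapping.single q d))
        (Poly_Mapping.single r e) =
      path_mult Q (Poly_Mapping.single p c)
        (path_mult Q (Poly_Mapping.single q d) (Poly_Mapping.single r e))" for p q r and c d e :: 'k
    by (cases p; cases q)
      (auto simp: path_mult_single comp_term_def path_end_append mult.assoc)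
  have *: "path_mult Q (path_mult Q (Poly_Mapping.single p c) (Poly_Mapping.single q d)) h =
      path_mult Q (Poly_Mapping.single p c) (path_mult Q (Poly_Mapping.single q d) h)" for p q c d
    using subset_UNIV [of "Poly_Mapping.keys h"]
    by (induction h rule: poly_mapping_induct_on) (simp_all add: path_mult_add_right single)
  have **: "path_mult Q (path_mult Q (Poly_Mapping.single p c) g) h =
      path_mult Q (Poly_Mapping.single p c) (path_mult Q g h)" for p c
    using subset_UNIV [of "Poly_Mapping.keys g"]
    by (induction g rule: poly_mapping_induct_on)
      (simp_all add: path_mult_add_right path_mult_add_left *)
  show ?thesis
    using subset_UNIV [of "Poly_Mapping.keys f"]
    by (induction f rule: poly_mapping_induct_on) (simp_all add: path_mult_add_left **)
qed

lemma scalar_zero [simp]: "scalar Q 0 = 0"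
  by (simp add: scalar_def)

lemma scalar_add: "scalar Q (c + d) = scalar Q c + scalar Q d"
  by (simp add: scalar_def single_add sum.distrib)

lemma path_end_Nil [simp]: "path_end Q (v, []) = v"
  by (simp add: path_end_conv)

lemma path_mult_sum_left: "path_mult Q (sum F A) g = (\<Sum>x\<in>A. path_mult Q (F x) g)"
  by (induction A rule: infinite_finite_induct) (simp_all add: path_mult_add_left)

lemma path_mult_sum_right: "path_mult Q f (sum F A) = (\<Sum>x\<in>A. path_mult Q f (F x))"
  by (induction A rule: infinite_finite_induct) (simp_all add: path_mult_add_right)

lemma scalar_mult_single:
  assumes "finite (verts Q)" "fst p \<in> verts Q"
  shows "path_mult Q (scalar Q c) (Poly_Mapping.single p d) = Poly_Mapping.single p (c * d)"
  using assms
  by (simp add: scalar_def path_mult_sum_left path_mult_single comp_term_def)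

lemma single_mult_scalar:
  assumes "finite (verts Q)" "path_end Q p \<in> verts Q"
  shows "path_mult Q (Poly_Mapping.single p d) (scalar Q c) = Poly_Mapping.single p (d * c)"
  using assms
  by (simp add: scalar_def path_mult_sum_right path_mult_single comp_term_def)

context fin_digraph
begin

lemma paths_iff: "(u, p) \<in> paths G \<longleftrightarrow> awalk u p (path_end G (u, p))"
  by (auto simp: paths_def path_end_def)

lemma fst_in_verts: "p \<in> paths G \<Longrightarrow> fst p \<in> verts G"
  by (cases p) (auto simp: paths_def)

lemma path_end_in_verts: "p \<in> paths G \<Longrightarrow> path_end G p \<in> verts G"
  by (cases p) (auto simp: paths_iff)

lemma Nil_in_paths [simp]: "(v, []) \<in> paths G \<longleftrightarrow> v \<in> verts G"
  by (simp add: paths_iff awalk_Nil_iff)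

lemma arc_in_paths: "a \<in> arcs G \<Longrightarrow> (tail G a, [a]) \<in> paths G"
  by (auto simp: paths_def intro: arc_implies_awalk)

lemma append_in_paths_iff:
  "(u, p @ q) \<in> paths G \<longleftrightarrow> (u, p) \<in> paths G \<and> (path_end G (u, p), q) \<in> paths G"
  by (auto simp: paths_def path_end_def)

lemma Cons_in_paths_iff:
  "(u, a # p) \<in> paths G \<longleftrightarrow> a \<in> arcs G \<and> u = tail G a \<and> (head G a, p) \<in> paths G"
  by (auto simp: paths_def awalk_Cons_iff)

lemma keys_scalar: "Poly_Mapping.keys (scalar G c) \<subseteq> paths G"
  unfolding scalar_def using keys_sum[of "\<lambda>v. Poly_Mapping.single (v, []) c" "verts G"]
  by (auto split: if_splits)

lemma keys_add_subset:
  "Poly_Mapping.keys f \<subseteq> A \<Longrightarrow> Poly_Mapping.keys g \<subseteq> A \<Longrightarrow> Poly_Mapping.keys (f + g) \<subseteq> A"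
  using keys_add[of f g] by blast

lemma keys_diff_subset:
  "Poly_Mapping.keys f \<subseteq> A \<Longrightarrow> Poly_Mapping.keys g \<subseteq> A \<Longrightarrow> Poly_Mapping.keys (f - g) \<subseteq> A"
  using keys_diff[of f g] by blast

lemma keys_comp_term:
  "p \<in> paths G \<Longrightarrow> q \<in> paths G \<Longrightarrow> Poly_Mapping.keys (comp_term G p q c) \<subseteq> paths G"
  by (cases p; cases q) (auto simp: comp_term_def append_in_paths_iff)

lemma keys_path_mult:
  assumes "Poly_Mapping.keys f \<subseteq> paths G" "Poly_Mapping.keys g \<subseteq> paths G"
  shows "Poly_Mapping.keys (path_mult G f g) \<subseteq> paths G"
  unfolding path_mult_alt using assms keys_comp_term
  by (intro order.trans [OF keys_sum] UN_least) blast

lemma path_mult_scalar_one: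
  assumes "Poly_Mapping.keys f \<subseteq> paths G"
  shows "path_mult G (scalar G 1) f = f" and "path_mult G f (scalar G 1) = f"
  using assms
  by (induction f rule: poly_mapping_induct_on)
    (simp_all add: path_mult_add_left path_mult_add_right scalar_mult_single single_mult_scalar
      fst_in_verts path_end_in_verts)

lemma path_algebra_simps [simp]:
  "carrier (path_algebra G) = {f. Poly_Mapping.keys f \<subseteq> paths G}"
  "x \<otimes>\<^bsub>path_algebra G\<^esub> y = path_mult G x y"
  "\<one>\<^bsub>path_algebra G\<^esub> = scalar G 1"
  "\<zero>\<^bsub>path_algebra G\<^esub> = 0"
  "x \<oplus>\<^bsub>path_algebra G\<^esub> y = x + y"
  by (simp_all add: path_algebra_def)

lemma keys_uminus [simp]: "Poly_Mapping.keys (- f) = Poly_Mapping.keys (f :: _ \<Rightarrow>\<^sub>0 'k::field)"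
  by (auto simp: in_keys_iff)

lemma ring_path_algebra: "ring (path_algebra G :: (('a,'b) qpath \<Rightarrow>\<^sub>0 'k::field) ring)"
proof (rule ringI)
  show "abelian_group (path_algebra G :: (('a,'b) qpath \<Rightarrow>\<^sub>0 'k) ring)"
  proof (rule abelian_groupI)
    fix x :: "('a,'b) qpath \<Rightarrow>\<^sub>0 'k" assume "x \<in> carrier (path_algebra G)"
    then show "\<exists>y\<in>carrier (path_algebra G). y \<oplus>\<^bsub>path_algebra G\<^esub> x = \<zero>\<^bsub>path_algebra G\<^esub>"
      by (intro bexI[of _ "- x"]) auto
  qed (simp_all add: keys_add_subset ac_simps)
  show "Group.monoid (path_algebra G :: (('a,'b) qpath \<Rightarrow>\<^sub>0 'k) ring)"
    by (rule monoidI)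
      (simp_all add: keys_path_mult keys_scalar path_mult_scalar_one path_mult_assoc)
qed (simp_all add: path_mult_add_left path_mult_add_right)

lemma path_algebra_a_inv:
  assumes "Poly_Mapping.keys f \<subseteq> paths G"
  shows "\<ominus>\<^bsub>path_algebra G\<^esub> f = - (f :: _ \<Rightarrow>\<^sub>0 'k::field)"
proof -
  interpret R: ring "path_algebra G :: (('a,'b) qpath \<Rightarrow>\<^sub>0 'k) ring"
    by (rule ring_path_algebra)
  show ?thesis
    using assms by (intro R.minus_equality) auto
qed

lemma path_algebra_a_minus:
  assumes "Poly_Mapping.keys g \<subseteq> paths G"
  shows "f \<ominus>\<^bsub>path_algebra G\<^esub> g = f - (g :: _ \<Rightarrow>\<^sub>0 'k::field)"
  by (simp add: a_minus_def path_algebra_a_inv assms)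

end

section \<open>Normal forms of paths\<close>

text \<open>\<open>nf p = None\<close> means that \<open>p\<close> is zero in the quotient.\<close>

locale normal_form = fin_digraph G for G :: "('a, 'b) pre_digraph" +
  fixes nf :: "('a, 'b) qpath \<Rightarrow> ('a, 'b) qpath option"
  assumes nf_path: "\<lbrakk>p \<in> paths G; nf p = Some p'\<rbrakk> \<Longrightarrow>
      p' \<in> paths G \<and> fst p' = fst p \<and> path_end G p' = path_end G p \<and> nf p' = Some p'"
    and nf_append_left: "(u, xs @ ys) \<in> paths G \<Longrightarrow>
      nf (u, xs @ ys) = Option.bind (nf (u, xs)) (\<lambda>p. nf (u, snd p @ ys))"
    and nf_append_right: "(u, xs @ ys) \<in> paths G \<Longrightarrow>
      nf (u, xs @ ys) = Option.bind (nf (path_end G (u, xs), ys)) (\<lambda>q. nf (u, xs @ snd q))"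
begin

definition normal_paths :: "('a, 'b) qpath set" where
  "normal_paths = {p \<in> paths G. nf p = Some p}"

definition reduce_term :: "('a, 'b) qpath \<Rightarrow> 'k::field \<Rightarrow> (('a, 'b) qpath \<Rightarrow>\<^sub>0 'k)" where
  "reduce_term p c = (case nf p of None \<Rightarrow> 0 | Some p' \<Rightarrow> Poly_Mapping.single p' c)"

text \<open>The linear extension of \<open>nf\<close>. It projects onto the span of
  \<open>normal_paths\<close>, which is how independence of normal paths modulo
  \<open>kernel\<close> is obtained.\<close>

definition reduce :: "(('a, 'b) qpath \<Rightarrow>\<^sub>0 'k::field) \<Rightarrow> (('a, 'b) qpath \<Rightarrow>\<^sub>0 'k)" where
  "reduce f = (\<Sum>p\<in>Poly_Mapping.keys f. reduce_term p (Poly_Mapping.lookup f p))"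

lemma reduce_term_zero [simp]: "reduce_term p 0 = 0"
  by (simp add: reduce_term_def split: option.split)

lemma reduce_zero [simp]: "reduce 0 = 0"
  by (simp add: reduce_def)

lemma reduce_single [simp]: "reduce (Poly_Mapping.single p c) = reduce_term p c"
  by (simp add: reduce_def)

lemma reduce_add: "reduce (f + g) = reduce f + reduce g"
  unfolding reduce_def
  by (rule setsum_keys_plus_distrib) (simp_all add: reduce_term_def single_add split: option.split)

lemma reduce_uminus: "reduce (- f) = - reduce f"
  using reduce_add[of f "- f"] by (simp add: eq_neg_iff_add_eq_0 add.commute)

lemma reduce_diff: "reduce (f - g) = reduce f - reduce g"
  using reduce_add[of f "- g"] by (simp add: reduce_uminus)

lemma normal_paths_subset: "normal_paths \<subseteq> paths G"
  by (auto simp: normal_paths_def)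

lemma keys_reduce:
  assumes "Poly_Mapping.keys f \<subseteq> paths G"
  shows "Poly_Mapping.keys (reduce f) \<subseteq> normal_paths"
proof -
  have "Poly_Mapping.keys (reduce_term p c) \<subseteq> normal_paths" if "p \<in> paths G" for p and c :: 'c
    using nf_path[OF that] by (auto simp: reduce_term_def normal_paths_def split: option.split)
  then show ?thesis
    unfolding reduce_def using assms by (intro order.trans [OF keys_sum] UN_least) blast
qed

lemma reduce_normal: "Poly_Mapping.keys f \<subseteq> normal_paths \<Longrightarrow> reduce f = f"
  by (induction f rule: poly_mapping_induct_on)
    (simp_all add: reduce_add reduce_term_def normal_paths_def)

text \<open>This makes \<open>kernel\<close> absorb factors on the right. On composable single paths
  it is \<open>nf_append_left\<close>; on the others both products vanish, because \<open>nf\<close>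
  keeps the end vertex. The companion for left factors rests in the same way on the preserved start
  vertex.\<close>

lemma reduce_mult_left:
  fixes f g :: "('a, 'b) qpath \<Rightarrow>\<^sub>0 'k::field"
  assumes "Poly_Mapping.keys f \<subseteq> paths G" "Poly_Mapping.keys g \<subseteq> paths G"
  shows "reduce (path_mult G f g) = reduce (path_mult G (reduce f) g)"
proof -
  have single: "reduce (path_mult G (Poly_Mapping.single p c) (Poly_Mapping.single q d)) =
      reduce (path_mult G (reduce_term p c) (Poly_Mapping.single q d))"
    if "p \<in> paths G" "q \<in> paths G" for p q and c d :: 'k
  proof (cases "path_end G p = fst q")
    case True
    with that have "(fst p, snd p @ snd q) \<in> paths G"
      by (cases p; cases q) (simp add: append_in_paths_iff)
    with nf_append_left[OF this] True show ?thesis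
      using nf_path[OF that(1)]
      by (cases "nf p") (simp_all add: path_mult_single comp_term_def reduce_term_def)
  next
    case False
    then show ?thesis
      using nf_path[OF that(1)]
      by (cases "nf p") (simp_all add: path_mult_single comp_term_def reduce_term_def)
  qed
  have *: "reduce (path_mult G (Poly_Mapping.single p c) g) = reduce (path_mult G (reduce_term p c) g)"
    if "p \<in> paths G" for p c
    using assms(2) that by (induction g rule: poly_mapping_induct_on)
      (simp_all add: path_mult_add_right reduce_add single)
  show ?thesis
    using assms(1) by (induction f rule: poly_mapping_induct_on)
      (simp_all add: path_mult_add_left reduce_add *)
qed

lemma reduce_mult_right:
  fixes f g :: "('a, 'b) qpath \<Rightarrow>\<^sub>0 'k::field"
  assumes "Poly_Mapping.keys f \<subseteq> paths G" "Poly_Mapping.keys g \<subseteq> paths G"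
  shows "reduce (path_mult G f g) = reduce (path_mult G f (reduce g))"
proof -
  have single: "reduce (path_mult G (Poly_Mapping.single p c) (Poly_Mapping.single q d)) =
      reduce (path_mult G (Poly_Mapping.single p c) (reduce_term q d))"
    if "p \<in> paths G" "q \<in> paths G" for p q and c d :: 'k
  proof (cases "path_end G p = fst q")
    case True
    with that have "(fst p, snd p @ snd q) \<in> paths G"
      by (cases p; cases q) (simp add: append_in_paths_iff)
    with nf_append_right[OF this] True show ?thesis
      using nf_path[OF that(2)]
      by (cases "nf q") (simp_all add: path_mult_single comp_term_def reduce_term_def)
  next
    case False
    then show ?thesis
      using nf_path[OF that(2)]
      by (cases "nf q") (simp_all add: path_mult_single comp_term_def reduce_term_def)
  qed
  have *: "reduce (path_mult G f (Poly_Mapping.single q d)) = reduce (path_mult G f (reduce_term q d))"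
    if "q \<in> paths G" for q d
    using assms(1) that by (induction f rule: poly_mapping_induct_on)
      (simp_all add: path_mult_add_left reduce_add single)
  show ?thesis
    using assms(2) by (induction g rule: poly_mapping_induct_on)
      (simp_all add: path_mult_add_right reduce_add *)
qed

definition kernel :: "(('a, 'b) qpath \<Rightarrow>\<^sub>0 'k::field) set" where
  "kernel = {f \<in> carrier (path_algebra G). reduce f = 0}"

lemma ideal_kernel: "ideal kernel (path_algebra G :: (('a,'b) qpath \<Rightarrow>\<^sub>0 'k::field) ring)"
proof -
  interpret R: ring "path_algebra G :: (('a,'b) qpath \<Rightarrow>\<^sub>0 'k) ring"
    by (rule ring_path_algebra)
  show ?thesis
  proof (rule idealI)
    show "subgroup kernel (add_monoid (path_algebra G :: (('a,'b) qpath \<Rightarrow>\<^sub>0 'k) ring))"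
    proof (rule R.add.subgroupI)
      show "(kernel :: (('a,'b) qpath \<Rightarrow>\<^sub>0 'k) set) \<noteq> {}"
        by (auto simp: kernel_def intro!: exI[of _ 0])
    qed (auto simp add: kernel_def path_algebra_a_inv reduce_uminus reduce_add keys_add_subset)
  next
    fix f g :: "('a,'b) qpath \<Rightarrow>\<^sub>0 'k"
    assume f: "f \<in> kernel" and g: "g \<in> carrier (path_algebra G)"
    show "g \<otimes>\<^bsub>path_algebra G\<^esub> f \<in> kernel"
      using f g reduce_mult_right[of g f] by (simp add: kernel_def keys_path_mult)
    show "f \<otimes>\<^bsub>path_algebra G\<^esub> g \<in> kernel"
      using f g reduce_mult_left[of f g] by (simp add: kernel_def keys_path_mult)
  qed (rule ring_path_algebra)
qed

text \<open>The first hypothesis says that the relations are sound, the second that they suffice to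
  rewrite every path. The second extends linearly to \<open>f - reduce f\<close>, and for
  \<open>f\<close> in the kernel this difference is \<open>f\<close> itself.\<close>

lemma genideal_eq_kernel:
  fixes S :: "(('a, 'b) qpath \<Rightarrow>\<^sub>0 'k::field) set"
  assumes S: "S \<subseteq> kernel"
    and red: "\<And>p. p \<in> paths G \<Longrightarrow> path_elem p - reduce_term p 1 \<in> Idl\<^bsub>path_algebra G\<^esub> S"
  shows "Idl\<^bsub>path_algebra G\<^esub> S = kernel"
proof
  interpret R: ring "path_algebra G :: (('a,'b) qpath \<Rightarrow>\<^sub>0 'k) ring"
    by (rule ring_path_algebra)
  show "Idl\<^bsub>path_algebra G\<^esub> S \<subseteq> kernel"
    by (rule R.genideal_minimal [OF ideal_kernel S])
  have "S \<subseteq> carrier (path_algebra G)"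
    using S by (auto simp: kernel_def)
  then interpret I: ideal "Idl\<^bsub>path_algebra G\<^esub> S" "path_algebra G :: (('a,'b) qpath \<Rightarrow>\<^sub>0 'k) ring"
    by (rule R.genideal_ideal)
  have add: "f + g \<in> Idl\<^bsub>path_algebra G\<^esub> S"
    if "f \<in> Idl\<^bsub>path_algebra G\<^esub> S" "g \<in> Idl\<^bsub>path_algebra G\<^esub> S" for f g
    using I.a_closed[OF that] by simp
  have diff: "f - reduce f \<in> Idl\<^bsub>path_algebra G\<^esub> S" if "Poly_Mapping.keys f \<subseteq> paths G" for f
    using that
  proof (induction f rule: poly_mapping_induct_on)
    case zero
    then show ?case using I.zero_closed by simp
  next
    case (plus p c f)
    \<comment> \<open>Ideals are ring ideals, so scaling by \<open>c\<close> has to be expressed as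
      multiplication by the ring element \<open>scalar G c\<close>.\<close>
    have "scalar G c \<otimes>\<^bsub>path_algebra G\<^esub> (path_elem p - reduce_term p 1) \<in> Idl\<^bsub>path_algebra G\<^esub> S"
      using I.I_l_closed[OF red[OF plus(1)], of "scalar G c"] by (simp add: keys_scalar)
    moreover have "path_mult G (scalar G c) (path_elem p - reduce_term p 1) =
        Poly_Mapping.single p c - reduce_term p c"
      using plus(1) nf_path[of p]
      by (auto simp: path_mult_diff scalar_mult_single fst_in_verts reduce_term_def
          split: option.split)
    ultimately have "(Poly_Mapping.single p c - reduce_term p c) + (f - reduce f)
        \<in> Idl\<^bsub>path_algebra G\<^esub> S"
      using add plus(3) by simp
    then show ?case
      by (simp add: reduce_add algebra_simps)
  qed
  show "kernel \<subseteq> Idl\<^bsub>path_algebra G\<^esub> S"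
  proof
    fix f :: "('a, 'b) qpath \<Rightarrow>\<^sub>0 'k" assume "f \<in> kernel"
    then show "f \<in> Idl\<^bsub>path_algebra G\<^esub> S"
      using diff[of f] by (simp add: kernel_def)
  qed
qed

end

section \<open>Scalars and dimension of the quotient\<close>

lemma quot_carrier_eq:
  "carrier (path_algebra Q Quot I) = (\<lambda>f. I +>\<^bsub>path_algebra Q\<^esub> f) ` carrier (path_algebra Q)"
  by (auto simp: FactRing_def A_RCOSETS_def')

context fin_digraph
begin

lemma scalar_mult_scalar:
  "path_mult G (scalar G c) (scalar G d) = scalar G (c * d)"
  unfolding scalar_def[of G d] scalar_def[of G "c * d"]
  by (simp add: path_mult_sum_right scalar_mult_single)

lemma scalar_uminus: "scalar G (- c) = - scalar G c"
  using scalar_add[of G c "- c"] by (simp add: eq_neg_iff_add_eq_0 add.commute)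

lemma coset_eq_iff:
  assumes "ideal I (path_algebra G :: (('a, 'b) qpath \<Rightarrow>\<^sub>0 'k::field) ring)"
    and "Poly_Mapping.keys f \<subseteq> paths G" "Poly_Mapping.keys g \<subseteq> paths G"
  shows "I +>\<^bsub>path_algebra G\<^esub> f = I +>\<^bsub>path_algebra G\<^esub> g \<longleftrightarrow> f - g \<in> I"
proof -
  interpret R: ring "path_algebra G :: (('a,'b) qpath \<Rightarrow>\<^sub>0 'k) ring"
    by (rule ring_path_algebra)
  show ?thesis
    using R.quotient_eq_iff_same_a_r_cos[OF assms(1), of f g] assms(2,3)
    by (simp add: path_algebra_a_minus)
qed

text \<open>Sending \<open>c\<close> to the coset of \<open>scalar G c\<close> respects sums and
  products, and properness of \<open>I\<close> keeps the images of 0 and 1 apart. Inverses are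
  therefore the images of inverses in the field.\<close>

lemma subfield_quot_scalars:
  assumes "ideal I (path_algebra G :: (('a, 'b) qpath \<Rightarrow>\<^sub>0 'k::field) ring)"
    and proper: "scalar G 1 \<notin> I"
  shows "subfield (quot_scalars G I) (quot_algebra G I)"
proof -
  interpret I: ideal I "path_algebra G :: (('a,'b) qpath \<Rightarrow>\<^sub>0 'k) ring"
    by (rule assms(1))
  interpret h: ring_hom_ring "path_algebra G :: (('a,'b) qpath \<Rightarrow>\<^sub>0 'k) ring" "quot_algebra G I"
      "(+>\<^bsub>path_algebra G\<^esub>) I"
    unfolding quot_algebra_def by (rule I.rcos_ring_hom_ring)
  let ?s = "\<lambda>c. I +>\<^bsub>path_algebra G\<^esub> scalar G c"
  have carr: "scalar G c \<in> carrier (path_algebra G)" for c :: 'k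
    by (simp add: keys_scalar)
  have mult: "?s c \<otimes>\<^bsub>quot_algebra G I\<^esub> ?s d = ?s (c * d)" for c d
    using h.hom_mult[OF carr[of c] carr[of d]] by (simp add: scalar_mult_scalar)
  have add: "?s c \<oplus>\<^bsub>quot_algebra G I\<^esub> ?s d = ?s (c + d)" for c d
    using h.hom_add[OF carr[of c] carr[of d]] by (simp add: scalar_add)
  have uminus: "\<ominus>\<^bsub>quot_algebra G I\<^esub> ?s c = ?s (- c)" for c
    using h.hom_a_inv[OF carr[of c]] by (simp add: scalar_uminus path_algebra_a_inv keys_scalar)
  have one: "\<one>\<^bsub>quot_algebra G I\<^esub> = ?s 1"
    using h.hom_one by simp
  have zero: "\<zero>\<^bsub>quot_algebra G I\<^esub> = ?s 0"
    using h.hom_zero by simp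
  have nonzero: "?s 1 \<noteq> ?s 0"
    using proper coset_eq_iff[OF assms(1), of "scalar G 1" "scalar G 0"]
    by (simp add: keys_scalar)
  have scal: "x \<in> quot_scalars G I \<longleftrightarrow> (\<exists>c. x = ?s c)" for x
    by (auto simp: quot_scalars_def)
  have subring: "subring (quot_scalars G I) (quot_algebra G I)"
  proof (rule h.S.subringI)
    show "quot_scalars G I \<subseteq> carrier (quot_algebra G I)"
      using h.hom_closed[OF carr] unfolding quot_scalars_def by blast
    show "\<one>\<^bsub>quot_algebra G I\<^esub> \<in> quot_scalars G I"
      unfolding scal one by blast
  next
    fix x assume "x \<in> quot_scalars G I"
    then show "\<ominus>\<^bsub>quot_algebra G I\<^esub> x \<in> quot_scalars G I"
      unfolding scal using uminus by blast
  next
    fix x y assume "x \<in> quot_scalars G I" "y \<in> quot_scalars G I"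
    then show "x \<otimes>\<^bsub>quot_algebra G I\<^esub> y \<in> quot_scalars G I"
      and "x \<oplus>\<^bsub>quot_algebra G I\<^esub> y \<in> quot_scalars G I"
      unfolding scal using mult add by blast+
  qed
  then have "subcring (quot_scalars G I) (quot_algebra G I)"
  proof (rule h.S.subcringI)
    fix x y assume "x \<in> quot_scalars G I" "y \<in> quot_scalars G I"
    then show "x \<otimes>\<^bsub>quot_algebra G I\<^esub> y = y \<otimes>\<^bsub>quot_algebra G I\<^esub> x"
      unfolding scal using mult by (metis mult.commute)
  qed
  then show ?thesis
  proof (rule h.S.subfieldI)
    show "Units (quot_algebra G I\<lparr>carrier := quot_scalars G I\<rparr>) =
        quot_scalars G I - {\<zero>\<^bsub>quot_algebra G I\<^esub>}"
    proof (intro equalityI subsetI)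
      fix x assume "x \<in> Units (quot_algebra G I\<lparr>carrier := quot_scalars G I\<rparr>)"
      then obtain y where "x \<in> quot_scalars G I" "y \<in> quot_scalars G I"
        and yx: "y \<otimes>\<^bsub>quot_algebra G I\<^esub> x = \<one>\<^bsub>quot_algebra G I\<^esub>"
        unfolding Units_def by auto
      then obtain c d where x: "x = ?s c" and "y = ?s d"
        unfolding scal by blast
      with yx have "?s (d * c) = ?s 1"
        by (simp only: mult one)
      then have "?s c \<noteq> ?s 0"
        using nonzero mult by (metis mult_zero_right)
      then show "x \<in> quot_scalars G I - {\<zero>\<^bsub>quot_algebra G I\<^esub>}"
        unfolding zero x using scal by blast
    next
      fix x assume "x \<in> quot_scalars G I - {\<zero>\<^bsub>quot_algebra G I\<^esub>}"
      then obtain c where x: "x = ?s c" and "c \<noteq> 0"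
        unfolding zero Diff_iff scal by blast
      have "?s (inverse c) \<otimes>\<^bsub>quot_algebra G I\<^esub> x = \<one>\<^bsub>quot_algebra G I\<^esub>"
        and "x \<otimes>\<^bsub>quot_algebra G I\<^esub> ?s (inverse c) = \<one>\<^bsub>quot_algebra G I\<^esub>"
        unfolding x mult one using \<open>c \<noteq> 0\<close> by simp_all
      moreover have "x \<in> quot_scalars G I" "?s (inverse c) \<in> quot_scalars G I"
        using x scal by blast+
      ultimately show "x \<in> Units (quot_algebra G I\<lparr>carrier := quot_scalars G I\<rparr>)"
        unfolding Units_def by (intro CollectI conjI bexI[of _ "?s (inverse c)"]) simp_all
    qed
  qed
qed

end

context normal_form
begin

text \<open>Adding one path at a time matches the inductive rule \<open>Suc_dim\<close>, which
  extends a space by the line through a vector outside it.\<close>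

lemma dimension_span_normal_paths:
  fixes B :: "('a, 'b) qpath set"
  assumes "finite B" "B \<subseteq> normal_paths"
  shows "ring.dimension (quot_algebra G (kernel :: (('a, 'b) qpath \<Rightarrow>\<^sub>0 'k::field) set)) (card B)
    (quot_scalars G kernel)
    ((\<lambda>f. kernel +>\<^bsub>path_algebra G\<^esub> f) ` {f. Poly_Mapping.keys f \<subseteq> B})"
  using assms
proof (induction B rule: finite_induct)
  case empty
  interpret I: ideal kernel "path_algebra G :: (('a,'b) qpath \<Rightarrow>\<^sub>0 'k) ring"
    by (rule ideal_kernel)
  interpret h: ring_hom_ring "path_algebra G :: (('a,'b) qpath \<Rightarrow>\<^sub>0 'k) ring"
      "quot_algebra G kernel" "(+>\<^bsub>path_algebra G\<^esub>) kernel"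
    unfolding quot_algebra_def by (rule I.rcos_ring_hom_ring)
  have "{f :: ('a,'b) qpath \<Rightarrow>\<^sub>0 'k. Poly_Mapping.keys f \<subseteq> {}} = {0}"
    by auto
  then show ?case
    using h.S.dimension.zero_dim h.hom_zero by simp
next
  case (insert b B)
  interpret I: ideal kernel "path_algebra G :: (('a,'b) qpath \<Rightarrow>\<^sub>0 'k) ring"
    by (rule ideal_kernel)
  interpret h: ring_hom_ring "path_algebra G :: (('a,'b) qpath \<Rightarrow>\<^sub>0 'k) ring"
      "quot_algebra G kernel" "(+>\<^bsub>path_algebra G\<^esub>) kernel"
    unfolding quot_algebra_def by (rule I.rcos_ring_hom_ring)
  let ?h = "\<lambda>f :: ('a,'b) qpath \<Rightarrow>\<^sub>0 'k. kernel +>\<^bsub>path_algebra G\<^esub> f"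
  let ?E = "?h ` {f. Poly_Mapping.keys f \<subseteq> B}"
  have b: "b \<in> paths G" and B: "B \<subseteq> paths G"
    using insert.prems normal_paths_subset by auto
  \<comment> \<open>\<open>reduce\<close> fixes combinations of normal paths, so two of them with
    the same coset are equal; but \<open>b\<close> is missing from the support of everything spanned
    by \<open>B\<close>.\<close>
  have "?h (path_elem b) \<notin> ?E"
  proof
    assume "?h (path_elem b) \<in> ?E"
    then obtain f :: "('a,'b) qpath \<Rightarrow>\<^sub>0 'k" where f: "Poly_Mapping.keys f \<subseteq> B"
      and "?h (path_elem b) = ?h f" by blast
    then have "reduce (path_elem b - f) = 0"
      using b B coset_eq_iff[OF ideal_kernel, of "path_elem b" f] by (auto simp: kernel_def)
    moreover have "reduce f = f" "reduce (path_elem b) = (path_elem b :: _ \<Rightarrow>\<^sub>0 'k)"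
      using f insert.prems by (auto intro: reduce_normal simp del: reduce_single)
    ultimately have "f = path_elem b"
      by (simp add: reduce_diff)
    then show False
      using f insert.hyps by simp
  qed
  moreover have "?h (path_elem b) \<in> carrier (quot_algebra G kernel)"
    using b by (intro h.hom_closed) simp
  moreover have "h.S.line_extension (quot_scalars G kernel) (?h (path_elem b)) ?E =
      ?h ` {f. Poly_Mapping.keys f \<subseteq> insert b B}"
  proof -
    have mult: "?h (scalar G c) \<otimes>\<^bsub>quot_algebra G kernel\<^esub> ?h (path_elem b) =
        ?h (Poly_Mapping.single b c)" for c
      using b h.hom_mult[of "scalar G c" "path_elem b"]
      by (simp add: keys_scalar scalar_mult_single fst_in_verts)
    have add: "?h (Poly_Mapping.single b c) \<oplus>\<^bsub>quot_algebra G kernel\<^esub> ?h f =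
        ?h (Poly_Mapping.single b c + f)" if "Poly_Mapping.keys f \<subseteq> B" for c f
      using b B that h.hom_add[of "Poly_Mapping.single b c" f] by auto
    have "h.S.line_extension (quot_scalars G kernel) (?h (path_elem b)) ?E =
        {?h (Poly_Mapping.single b c + f) | c f. Poly_Mapping.keys f \<subseteq> B}"
      unfolding h.S.line_extension_def set_add_def' r_coset_def quot_scalars_def
      by (auto simp: mult add)
    also have "\<dots> = ?h ` {f. Poly_Mapping.keys f \<subseteq> insert b B}"
    proof (intro equalityI subsetI)
      fix x assume "x \<in> {?h (Poly_Mapping.single b c + f) | c f. Poly_Mapping.keys f \<subseteq> B}"
      then obtain c f where x: "x = ?h (Poly_Mapping.single b c + f)"
        and f: "Poly_Mapping.keys f \<subseteq> B" by blast
      have "Poly_Mapping.keys (Poly_Mapping.single b c + f) \<subseteq> insert b B"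
        using f by (intro keys_add_subset) auto
      then show "x \<in> ?h ` {f. Poly_Mapping.keys f \<subseteq> insert b B}"
        unfolding x by blast
    next
      fix x assume "x \<in> ?h ` {f. Poly_Mapping.keys f \<subseteq> insert b B}"
      then obtain g where x: "x = ?h g" and g: "Poly_Mapping.keys g \<subseteq> insert b B" by blast
      define f where "f = g - Poly_Mapping.single b (Poly_Mapping.lookup g b)"
      have "Poly_Mapping.keys f \<subseteq> B"
      proof
        fix p assume "p \<in> Poly_Mapping.keys f"
        then show "p \<in> B"
          using g unfolding in_keys_iff f_def lookup_minus lookup_single
          by (cases "p = b") (auto simp: in_keys_iff when_def)
      qed
      moreover have "x = ?h (Poly_Mapping.single b (Poly_Mapping.lookup g b) + f)"
        by (simp add: f_def x)
      ultimately show "x \<in> {?h (Poly_Mapping.single b c + f) | c f. Poly_Mapping.keys f \<subseteq> B}"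
        by blast
    qed
    finally show ?thesis .
  qed
  ultimately show ?case
    using h.S.dimension.Suc_dim[of "?h (path_elem b)" ?E "card B" "quot_scalars G kernel"] insert by simp
qed

text \<open>Every coset contains its reduced representative, so the normal paths span. One normal
  path is enough to keep 1 out of the kernel, since it survives reduction; this is what turns the
  scalars into a subfield.\<close>

lemma quot_dim_kernel:
  assumes "finite normal_paths" "normal_paths \<noteq> {}"
  shows "quot_finite_dim G (kernel :: (('a, 'b) qpath \<Rightarrow>\<^sub>0 'k::field) set)"
    and "quot_dim G (kernel :: (('a, 'b) qpath \<Rightarrow>\<^sub>0 'k) set) = card normal_paths"
proof -
  interpret I: ideal kernel "path_algebra G :: (('a,'b) qpath \<Rightarrow>\<^sub>0 'k) ring"
    by (rule ideal_kernel)
  interpret S: ring "quot_algebra G (kernel :: (('a,'b) qpath \<Rightarrow>\<^sub>0 'k) set)"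
    unfolding quot_algebra_def by (rule I.quotient_is_ring)
  let ?h = "\<lambda>f :: ('a,'b) qpath \<Rightarrow>\<^sub>0 'k. kernel +>\<^bsub>path_algebra G\<^esub> f"
  have "?h ` {f. Poly_Mapping.keys f \<subseteq> normal_paths} = carrier (quot_algebra G kernel)"
  proof -
    have reduce: "?h f = ?h (reduce f)" if "Poly_Mapping.keys f \<subseteq> paths G" for f
    proof -
      have sub: "Poly_Mapping.keys (reduce f) \<subseteq> paths G"
        using keys_reduce[OF that] normal_paths_subset by (rule order.trans)
      then have "f - reduce f \<in> kernel"
        using that reduce_normal[OF keys_reduce[OF that]] keys_add_subset[of f _ "- reduce f"]
        by (simp add: kernel_def reduce_diff)
      then show ?thesis
        using coset_eq_iff[OF ideal_kernel that sub] by simp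
    qed
    have "?h ` {f. Poly_Mapping.keys f \<subseteq> normal_paths} = ?h ` {f. Poly_Mapping.keys f \<subseteq> paths G}"
    proof (intro equalityI image_subsetI)
      fix f :: "('a,'b) qpath \<Rightarrow>\<^sub>0 'k" assume "f \<in> {f. Poly_Mapping.keys f \<subseteq> paths G}"
      then show "?h f \<in> ?h ` {f. Poly_Mapping.keys f \<subseteq> normal_paths}"
        using reduce[of f] keys_reduce[of f] by simp
    qed (use normal_paths_subset in auto)
    then show ?thesis
      by (simp add: quot_algebra_def quot_carrier_eq)
  qed
  then have dim: "S.dimension (card normal_paths) (quot_scalars G kernel)
      (carrier (quot_algebra G kernel))"
    using dimension_span_normal_paths[OF assms(1) order_refl, where ?'k = 'k] by simp
  obtain b where b: "b \<in> normal_paths" using assms(2) by blast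
  have "scalar G 1 \<notin> (kernel :: (('a,'b) qpath \<Rightarrow>\<^sub>0 'k) set)"
  proof
    assume "scalar G 1 \<in> (kernel :: (('a,'b) qpath \<Rightarrow>\<^sub>0 'k) set)"
    then have "(kernel :: (('a,'b) qpath \<Rightarrow>\<^sub>0 'k) set) = carrier (path_algebra G)"
      using I.one_imp_carrier by simp
    then have "reduce (path_elem b) = (0 :: _ \<Rightarrow>\<^sub>0 'k)"
      using b normal_paths_subset by (force simp: kernel_def simp del: reduce_single)
    moreover have "reduce (path_elem b) = (path_elem b :: _ \<Rightarrow>\<^sub>0 'k)"
      using b by (intro reduce_normal) simp
    ultimately show False
      by (metis lookup_single_eq lookup_zero one_neq_zero)
  qed
  then have "subfield (quot_scalars G kernel) (quot_algebra G (kernel :: (('a,'b) qpath \<Rightarrow>\<^sub>0 'k) set))"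
    by (rule subfield_quot_scalars[OF ideal_kernel])
  from S.dimI[OF this dim] show "quot_dim G (kernel :: (('a, 'b) qpath \<Rightarrow>\<^sub>0 'k) set) = card normal_paths"
    by (simp add: quot_dim_def over_def)
  from dim show "quot_finite_dim G (kernel :: (('a, 'b) qpath \<Rightarrow>\<^sub>0 'k) set)"
    unfolding quot_finite_dim_def by (rule S.finite_dimensionI)
qed

end

section \<open>Chains of a partial injection\<close>

text \<open>Abstracts nonzero composition of arrows: uniqueness on both sides is (S1), and the bound
  \<open>N\<close> will come from nilpotency of the arrow ideal. The bound rules out cyclic orbits,
  so \<open>X\<close> decomposes into finite strings.\<close>

locale bounded_chains =
  fixes X :: "'a set" and s :: "'a \<Rightarrow> 'a \<Rightarrow> bool" and N :: nat
  assumes finite_X: "finite X"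
    and s_in_X: "s a b \<Longrightarrow> a \<in> X \<and> b \<in> X"
    and right_unique: "s a b \<Longrightarrow> s a c \<Longrightarrow> b = c"
    and left_unique: "s b a \<Longrightarrow> s c a \<Longrightarrow> b = c"
    and bounded: "set l \<subseteq> X \<Longrightarrow> successively s l \<Longrightarrow> length l < N"
begin

definition chains :: "'a list set" where
  "chains = {l. l \<noteq> [] \<and> set l \<subseteq> X \<and> successively s l}"

definition max_chains :: "'a list set" where
  "max_chains = {l \<in> chains. \<forall>a. \<not> s a (hd l) \<and> \<not> s (last l) a}"

lemma finite_chains: "finite chains"
  by (rule finite_subset[OF _ finite_lists_length_le[OF finite_X, of N]])
    (use bounded in \<open>auto simp: chains_def dest: less_imp_le\<close>)

lemma finite_max_chains: "finite max_chains"
  by (rule finite_subset[OF _ finite_chains]) (auto simp: max_chains_def)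

text \<open>The continuation from \<open>a\<close> is forced, so two chains starting there are
  comparable, and one that cannot be extended is the longer. The relation is a variable so that the
  converse of \<open>s\<close> can be inserted as well.\<close>

lemma chain_prefix:
  assumes "successively r (a # zs)" "successively r (a # ys)" "\<And>b. \<not> r (last (a # ys)) b"
    and "\<And>a b c. r a b \<Longrightarrow> r a c \<Longrightarrow> b = c"
  shows "\<exists>ws. ys = zs @ ws"
  using assms(1-3)
proof (induction zs arbitrary: a ys)
  case (Cons z zs)
  \<comment> \<open>If \<open>ys\<close> were empty, \<open>z\<close> would extend the chain beyond
    its last entry \<open>a\<close>.\<close>
  then obtain y ys' where ys: "ys = y # ys'"
    by (cases ys) auto
  with Cons.prems assms(4) have "y = z"
    by (auto simp: successively_Cons)
  with Cons.IH[of z ys'] Cons.prems show ?case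
    by (simp add: ys)
qed simp

text \<open>Both halves around \<open>a\<close> are forced, the left one after reversal.
  Consequently a maximal chain repeats no entry, and distinct maximal chains are disjoint.\<close>

lemma max_chain_unique:
  assumes "m \<in> max_chains" "m' \<in> max_chains" "m = xs @ a # ys" "m' = xs' @ a # ys'"
  shows "xs = xs' \<and> ys = ys'"
proof -
  have right: "ys = ys'"
  proof -
    have "successively s (a # ys)" "successively s (a # ys')"
      and "\<not> s (last (a # ys)) b" "\<not> s (last (a # ys')) b" for b
      using assms by (auto simp: max_chains_def chains_def successively_append_iff)
    then have "\<exists>ws. ys = ys' @ ws" "\<exists>ws. ys' = ys @ ws"
      using chain_prefix[of s a] right_unique by metis+
    then show ?thesis by auto
  qed
  have "rev xs = rev xs'"
  proof -
    let ?r = "\<lambda>a b. s b a"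
    have "successively s (xs @ [a])" "successively s (xs' @ [a])"
      using assms by (auto simp: max_chains_def chains_def successively_append_iff)
    then have "successively ?r (a # rev xs)" "successively ?r (a # rev xs')"
      using successively_rev[of ?r "xs @ [a]"] successively_rev[of ?r "xs' @ [a]"] by simp_all
    \<comment> \<open>The reversed left half ends in the head of the maximal chain, which has no
      predecessor.\<close>
    moreover have "\<not> ?r (last (a # rev xs)) b" "\<not> ?r (last (a # rev xs')) b" for b
      using assms by (cases xs; cases xs'; auto simp: max_chains_def)+
    ultimately have "\<exists>ws. rev xs = rev xs' @ ws" "\<exists>ws. rev xs' = rev xs @ ws"
      using chain_prefix[of ?r a] left_unique by metis+
    then show ?thesis by auto
  qed
  then show ?thesis using right by simp
qed

text \<open>A longest chain through \<open>x\<close> exists because there are finitely many chains,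
  and an extension at either end would still contain \<open>x\<close>.\<close>

lemma in_max_chain:
  assumes "x \<in> X"
  shows "\<exists>m\<in>max_chains. x \<in> set m"
proof -
  let ?L = "{l \<in> chains. x \<in> set l}"
  have "finite ?L"
    by (rule finite_subset[OF _ finite_chains]) blast
  have "[x] \<in> ?L"
    using assms by (simp add: chains_def)
  with \<open>finite ?L\<close> have "Max (length ` ?L) \<in> length ` ?L"
    by (intro Max_in) auto
  then obtain m where m: "m \<in> chains" "x \<in> set m" and "length m = Max (length ` ?L)"
    by auto
  then have max: "length l \<le> length m" if "l \<in> chains" "x \<in> set l" for l
    using that \<open>finite ?L\<close> by simp
  have "\<not> s a (hd m)" for a
  proof
    assume "s a (hd m)"
    then have "a # m \<in> chains"
      using m(1) s_in_X[of a "hd m"] by (simp add: chains_def successively_Cons)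
    with max[of "a # m"] m(2) show False by simp
  qed
  moreover have "\<not> s (last m) a" for a
  proof
    assume "s (last m) a"
    then have "m @ [a] \<in> chains"
      using m(1) s_in_X[of "last m" a] by (simp add: chains_def successively_append_iff)
    with max[of "m @ [a]"] m(2) show False by simp
  qed
  ultimately have "m \<in> max_chains"
    using m(1) by (simp add: max_chains_def)
  with m(2) show ?thesis by blast
qed

text \<open>The triple encodes the entries of \<open>m\<close> from position \<open>i\<close> up to,
  but excluding, \<open>j\<close>. The first entry of a chain determines \<open>m\<close> and
  \<open>i\<close> by \<open>max_chain_unique\<close>, and the length then determines
  \<open>j\<close>. Choosing \<open>j\<close> before \<open>i\<close> makes the number of triples
  for a fixed \<open>m\<close> a Gauss sum.\<close>

lemma bij_betw_chains:
  "bij_betw (\<lambda>(m, j, i). drop i (take j m))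
     (SIGMA m:max_chains. SIGMA j:{..length m}. {..<j}) chains"
  unfolding bij_betw_def
proof
  let ?f = "\<lambda>(m, j, i). drop i (take j m)" and ?A = "SIGMA m:max_chains. SIGMA j:{..length m}. {..<j}"
  have split: "m = take i m @ m ! i # drop (Suc i) m" "hd (drop i (take j m)) = m ! i"
    if "j \<le> length m" "i < j" for i j and m :: "'a list"
    using that by (simp_all add: id_take_nth_drop hd_drop_conv_nth)
  show "inj_on ?f ?A"
  proof (rule inj_onI, clarsimp)
    fix m j i m' j' i'
    assume m: "m \<in> max_chains" "j \<le> length m" "i < j"
      and m': "m' \<in> max_chains" "j' \<le> length m'" "i' < j'"
      and eq: "drop i (take j m) = drop i' (take j' m')"
    then have hd: "m ! i = m' ! i'"
      using split(2) by metis
    have *: "take i m = take i' m' \<and> drop (Suc i) m = drop (Suc i') m'"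
      using max_chain_unique[OF m(1) m'(1) split(1)[OF m(2,3)]] split(1)[OF m'(2,3)] hd by metis
    then have "length (take i m) = length (take i' m')" by simp
    then have "i = i'" using m m' by simp
    moreover have "m = m'"
      using split(1)[OF m(2,3)] split(1)[OF m'(2,3)] * hd by metis
    moreover have "j = j'"
      using arg_cong[OF eq, of length] m m' \<open>i = i'\<close> by simp
    ultimately show "m = m' \<and> j = j' \<and> i = i'" by simp
  qed
  show "?f ` ?A = chains"
  proof (intro equalityI subsetI)
    fix l assume "l \<in> ?f ` ?A"
    then obtain m i j where m: "m \<in> max_chains" "j \<le> length m" "i < j" and l: "l = drop i (take j m)"
      by auto
    have "m = take i m @ l @ drop j m"
      unfolding l using m by (metis append_assoc append_take_drop_id less_imp_le min.absorb1 take_take)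
    then have "set l \<subseteq> X \<and> successively s l"
      using m(1) unfolding max_chains_def chains_def
      by (metis (no_types, lifting) CollectD successively_append_iff set_append Un_subset_iff)
    then show "l \<in> chains"
      using m by (simp add: chains_def l)
  next
    fix l assume l: "l \<in> chains"
    then obtain a zs where az: "l = a # zs" by (cases l) (auto simp: chains_def)
    then obtain m where m: "m \<in> max_chains" "a \<in> set m"
      using in_max_chain[of a] l by (auto simp: chains_def)
    then obtain xs ys where m_eq: "m = xs @ a # ys"
      by (meson split_list)
    \<comment> \<open>The chain that cannot be extended is the rest of \<open>m\<close> from
      \<open>a\<close> on, so \<open>l\<close> is an initial piece of it.\<close>
    have "\<exists>ws. ys = zs @ ws"
      using l m m_eq az right_unique
      by (intro chain_prefix[of s a]) (auto simp: chains_def max_chains_def successively_append_iff)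
    then obtain ws where "ys = zs @ ws" by blast
    then have "l = ?f (m, length xs + length l, length xs)"
      and "(m, length xs + length l, length xs) \<in> ?A"
      using m by (auto simp: m_eq az)
    then show "l \<in> ?f ` ?A" by (rule image_eqI)
  qed
qed

text \<open>The factor 2 clears the denominator of the Gauss sum, so that no division of natural
  numbers occurs.\<close>

lemma card_chains: "2 * card chains = (\<Sum>m\<in>max_chains. length m * (length m + 1))"
proof -
  have "card chains = card (SIGMA m:max_chains. SIGMA j:{..length m}. {..<j})"
    using bij_betw_same_card[OF bij_betw_chains] by simp
  also have "\<dots> = (\<Sum>m\<in>max_chains. \<Sum>j\<le>length m. j)"
    by (simp add: card_SigmaI finite_max_chains)
  finally have "2 * card chains = (\<Sum>m\<in>max_chains. 2 * (\<Sum>j\<le>length m. j))"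
    by (simp add: sum_distrib_left)
  moreover have "2 * (\<Sum>j\<le>n. j) = n * (n + 1)" for n :: nat
    using double_gauss_sum[of n, where ?'a = nat] by (simp add: atMost_atLeast0)
  ultimately show ?thesis by simp
qed

end

section \<open>Quadratic monomial relations\<close>

lemma not_successivelyD:
  "\<not> successively P xs \<Longrightarrow> \<exists>as a b bs. xs = as @ [a, b] @ bs \<and> \<not> P a b"
proof (induction P xs rule: successively.induct)
  case (3 P x y xs)
  show ?case
  proof (cases "P x y")
    case True
    with 3 obtain as a b bs where "y # xs = as @ [a, b] @ bs" "\<not> P a b" by auto
    then show ?thesis by (intro exI[of _ "x # as"]) auto
  qed (auto intro: exI[of _ "[]"])
qed auto

context fin_digraph
begin

lemma in_paths_iff:
  "(u, p) \<in> paths G \<longleftrightarrow> (if p = [] then u \<in> verts G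
     else u = tail G (hd p) \<and> set p \<subseteq> arcs G \<and> successively (\<lambda>a b. head G a = tail G b) p)"
proof (induction p arbitrary: u)
  case (Cons a p)
  then show ?case
    by (auto simp: Cons_in_paths_iff successively_Cons)
qed simp

lemma arcs_of_path: "(u, p) \<in> paths G \<Longrightarrow> set p \<subseteq> arcs G"
  by (auto simp: in_paths_iff split: if_splits)

lemma path_mult_path_elem:
  "path_mult G (path_elem (u, xs)) (path_elem (path_end G (u, xs), ys)) = path_elem (u, xs @ ys)"
  by (simp add: path_mult_single comp_term_def)

lemma path_elem_in_ideal:
  fixes I :: "(('a, 'b) qpath \<Rightarrow>\<^sub>0 'k::field) set"
  assumes "ideal I (path_algebra G)" "(u, xs @ ys @ zs) \<in> paths G"
    and "path_elem (path_end G (u, xs), ys) \<in> I"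
  shows "path_elem (u, xs @ ys @ zs) \<in> I"
proof -
  interpret I: ideal I "path_algebra G :: (('a,'b) qpath \<Rightarrow>\<^sub>0 'k) ring"
    by (rule assms(1))
  have "path_mult G (path_elem (u, xs)) (path_elem (path_end G (u, xs), ys)) \<in> I"
    using I.I_l_closed[OF assms(3), of "path_elem (u, xs)"] assms(2) by (simp add: append_in_paths_iff)
  then have "path_elem (u, xs @ ys) \<in> I"
    by (simp add: path_mult_path_elem)
  then have "path_mult G (path_elem (u, xs @ ys)) (path_elem (path_end G (u, xs @ ys), zs)) \<in> I"
    using I.I_r_closed[of "path_elem (u, xs @ ys)" "path_elem (path_end G (u, xs @ ys), zs)"] assms(2)
    by (simp add: append_in_paths_iff path_end_append)
  then show ?thesis
    by (simp add: path_mult_path_elem)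
qed

end

locale quadratic_monomial = fin_digraph G for G :: "('a, 'b) pre_digraph" +
  fixes P :: "('a, 'b) qpath set"
  assumes quadratic: "P \<subseteq> {p \<in> paths G. path_length p = 2}"
begin

definition nonzero_path :: "('a, 'b) qpath \<Rightarrow> bool" where
  "nonzero_path p \<longleftrightarrow> successively (\<lambda>a b. (tail G a, [a, b]) \<notin> P) (snd p)"

definition nonzero_normal_form :: "('a, 'b) qpath \<Rightarrow> ('a, 'b) qpath option" where
  "nonzero_normal_form p = (if nonzero_path p then Some p else None)"

text \<open>A nonzero path is its own normal form, and a concatenation avoids \<open>P\<close> only
  if both factors do. Both append laws follow from this.\<close>

sublocale nf: normal_form G nonzero_normal_form
  by unfold_locales
    (auto simp: nonzero_normal_form_def nonzero_path_def successively_append_iff split: if_splits)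

text \<open>A path that is not nonzero contains a pair from \<open>P\<close> as a subpath, hence is
  a two-sided multiple of a relation.\<close>

lemma genideal_eq_kernel: "Idl\<^bsub>path_algebra G\<^esub> (path_elem ` P) = (nf.kernel :: (_ \<Rightarrow>\<^sub>0 'k::field) set)"
proof (rule nf.genideal_eq_kernel)
  interpret R: ring "path_algebra G :: (('a,'b) qpath \<Rightarrow>\<^sub>0 'k) ring"
    by (rule ring_path_algebra)
  show "path_elem ` P \<subseteq> (nf.kernel :: (_ \<Rightarrow>\<^sub>0 'k) set)"
  proof
    fix f :: "('a,'b) qpath \<Rightarrow>\<^sub>0 'k" assume "f \<in> path_elem ` P"
    then obtain p where p: "p \<in> P" "f = path_elem p" by blast
    moreover from this obtain u a b where "p = (u, [a, b])" "p \<in> paths G"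
      using quadratic by (cases p) (auto simp: length_Suc_conv numeral_2_eq_2)
    ultimately show "f \<in> nf.kernel"
      by (auto simp: nf.kernel_def nf.reduce_term_def nonzero_normal_form_def nonzero_path_def
          Cons_in_paths_iff)
  qed
  then have carr: "path_elem ` P \<subseteq> carrier (path_algebra G :: (('a,'b) qpath \<Rightarrow>\<^sub>0 'k) ring)"
    unfolding nf.kernel_def by blast
  interpret I: ideal "Idl\<^bsub>path_algebra G\<^esub> (path_elem ` P)" "path_algebra G :: (('a,'b) qpath \<Rightarrow>\<^sub>0 'k) ring"
    by (rule R.genideal_ideal[OF carr])
  fix p assume p: "p \<in> paths G"
  show "path_elem p - nf.reduce_term p 1 \<in> Idl\<^bsub>path_algebra G\<^esub> (path_elem ` P :: (_ \<Rightarrow>\<^sub>0 'k) set)"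
  proof (cases "nonzero_path p")
    case True
    then show ?thesis
      using I.zero_closed by (simp add: nf.reduce_term_def nonzero_normal_form_def)
  next
    case False
    then obtain as a b bs where snd: "snd p = as @ [a, b] @ bs" and P: "(tail G a, [a, b]) \<in> P"
      using not_successivelyD unfolding nonzero_path_def by blast
    obtain u where u: "p = (u, as @ [a, b] @ bs)"
      using snd by (cases p) auto
    have "path_end G (u, as) = tail G a"
      using p by (simp add: u append_in_paths_iff Cons_in_paths_iff)
    then have "path_elem p \<in> Idl\<^bsub>path_algebra G\<^esub> (path_elem ` P :: (_ \<Rightarrow>\<^sub>0 'k) set)"
      unfolding u using p P R.genideal_self[OF carr]
      by (intro path_elem_in_ideal[OF I.ideal_axioms]) (auto simp: u)
    then show ?thesis
      using False by (simp add: nf.reduce_term_def nonzero_normal_form_def)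
  qed
qed

lemma path_elem_in_genideal_iff:
  assumes "p \<in> paths G"
  shows "path_elem p \<in> Idl\<^bsub>path_algebra G\<^esub> (path_elem ` P :: (_ \<Rightarrow>\<^sub>0 'k::field) set) \<longleftrightarrow> \<not> nonzero_path p"
  using assms unfolding genideal_eq_kernel
  by (auto simp: nf.kernel_def nf.reduce_term_def nonzero_normal_form_def dest!: arg_cong[of _ _ Poly_Mapping.keys])

end

section \<open>Cyclic relations\<close>

text \<open>The length \<open>n a\<close> of the cycle through \<open>a\<close> is any period of \<open>\<sigma>\<close> at \<open>a\<close>; minimality is not
  required.\<close>

locale cyclic_successor = fin_digraph G for G :: "('a, 'b) pre_digraph" +
  fixes \<sigma> :: "'b \<Rightarrow> 'b" and n :: "'b \<Rightarrow> nat"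
  assumes successor_arc: "a \<in> arcs G \<Longrightarrow> \<sigma> a \<in> arcs G"
    and head_eq: "a \<in> arcs G \<Longrightarrow> head G a = tail G (\<sigma> a)"
    and period_pos: "a \<in> arcs G \<Longrightarrow> 0 < n a"
    and period_successor: "a \<in> arcs G \<Longrightarrow> n (\<sigma> a) = n a"
    and funpow_period: "a \<in> arcs G \<Longrightarrow> (\<sigma> ^^ n a) a = a"
    and ex_out_arc: "v \<in> verts G \<Longrightarrow> \<exists>a\<in>arcs G. tail G a = v"
begin

abbreviation chain :: "'b list \<Rightarrow> bool" where
  "chain \<equiv> successively (\<lambda>a b. b = \<sigma> a)"

text \<open>With a unique successor for each arrow, a chain is known from its first arrow and its
  length. Pairs \<open>(a, k)\<close> thus replace lists in the later count; \<open>k\<close> may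
  exceed the period, in which case the segment wraps around.\<close>

definition segment :: "'b \<Rightarrow> nat \<Rightarrow> 'b list" where
  "segment a k = map (\<lambda>i. (\<sigma> ^^ i) a) [0..<k]"

abbreviation full_cycle :: "'b \<Rightarrow> 'b list" where
  "full_cycle a \<equiv> segment a (n a)"

definition out_arc :: "'a \<Rightarrow> 'b" where
  "out_arc v = (SOME a. a \<in> arcs G \<and> tail G a = v)"

lemma out_arc: "v \<in> verts G \<Longrightarrow> out_arc v \<in> arcs G \<and> tail G (out_arc v) = v"
  unfolding out_arc_def by (rule someI_ex) (use ex_out_arc in blast)

lemma length_segment [simp]: "length (segment a k) = k"
  by (simp add: segment_def)

lemma segment_eq_Nil_iff [simp]: "segment a k = [] \<longleftrightarrow> k = 0"
  by (simp add: segment_def)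

lemma Nil_eq_segment_iff [simp]: "[] = segment a k \<longleftrightarrow> k = 0"
  by (auto simp: segment_def)

lemma segment_0 [simp]: "segment a 0 = []"
  by (simp add: segment_def)

lemma hd_segment [simp]: "0 < k \<Longrightarrow> hd (segment a k) = a"
  by (simp add: segment_def hd_map)

lemma segment_eqD:
  assumes "segment a k = segment a' k'" "0 < k"
  shows "a = a' \<and> k = k'"
proof -
  have "k = k'"
    using assms(1) by (metis length_segment)
  with assms show ?thesis
    by (metis hd_segment)
qed

lemma nth_segment: "i < k \<Longrightarrow> segment a k ! i = (\<sigma> ^^ i) a"
  by (simp add: segment_def)

lemma chain_segment: "chain (segment a k)"
  by (simp add: successively_conv_nth nth_segment)

lemma nth_chain: "chain xs \<Longrightarrow> i < length xs \<Longrightarrow> xs ! i = (\<sigma> ^^ i) (hd xs)"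
proof (induction i)
  case 0
  then show ?case by (simp add: hd_conv_nth)
next
  case (Suc i)
  then show ?case by (simp add: successively_conv_nth)
qed

lemma chain_eq_segment: "chain xs \<Longrightarrow> xs = segment (hd xs) (length xs)"
  by (rule nth_equalityI) (simp_all add: nth_segment nth_chain)

lemma funpow_arc: "a \<in> arcs G \<Longrightarrow> (\<sigma> ^^ i) a \<in> arcs G \<and> n ((\<sigma> ^^ i) a) = n a"
  by (induction i) (simp_all add: successor_arc period_successor)

lemma set_segment: "a \<in> arcs G \<Longrightarrow> set (segment a k) \<subseteq> arcs G"
  using funpow_arc by (auto simp: segment_def)

lemma segment_in_paths:
  assumes "a \<in> arcs G"
  shows "(tail G a, segment a k) \<in> paths G"
proof (cases "k = 0")
  case False
  have "successively (\<lambda>a b. head G a = tail G b) (segment a k)"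
    using chain_segment[of a k] set_segment[OF assms, of k] head_eq
    by (auto intro: successively_mono)
  then show ?thesis
    using False set_segment[OF assms] by (simp add: in_paths_iff)
qed (use assms in simp)

lemma path_end_segment: "a \<in> arcs G \<Longrightarrow> path_end G (tail G a, segment a k) = tail G ((\<sigma> ^^ k) a)"
  using funpow_arc[of a "k - 1"] head_eq[of "(\<sigma> ^^ (k - 1)) a"]
  by (cases k) (auto simp: path_end_conv last_conv_nth nth_segment)

lemma path_end_cycle: "a \<in> arcs G \<Longrightarrow> path_end G (tail G a, full_cycle a) = tail G a"
  by (simp add: path_end_segment funpow_period)

text \<open>Both heads lie on the same orbit of \<sigma>, along which \<open>n\<close> is constant.
  A length bound read off at the head of a suffix can thereby be compared with the bound for the
  whole chain.\<close>

lemma period_hd_append: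
  assumes "chain (xs @ ys)" "set (xs @ ys) \<subseteq> arcs G" "ys \<noteq> []"
  shows "n (hd (xs @ ys)) = n (hd ys)"
proof -
  have "hd ys = (\<sigma> ^^ length xs) (hd (xs @ ys))"
    using assms nth_chain[OF assms(1), of "length xs"] by (simp add: hd_conv_nth nth_append)
  moreover have "hd (xs @ ys) \<in> arcs G"
    using assms(2,3) hd_in_set[of "xs @ ys"] by blast
  ultimately show ?thesis
    using funpow_arc by metis
qed

text \<open>Full cycles at the same vertex are equal in the quotient; the one that starts with \<open>out_arc\<close>
  represents them.\<close>

definition cycle_normal_form :: "('a, 'b) qpath \<Rightarrow> ('a, 'b) qpath option" where
  "cycle_normal_form p =
     (if snd p = [] then Some p
      else if chain (snd p) \<and> length (snd p) < n (hd (snd p)) then Some p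
      else if chain (snd p) \<and> length (snd p) = n (hd (snd p)) then Some (fst p, full_cycle (out_arc (fst p)))
      else None)"

lemma cycle_normal_form_cases:
  obtains (normal) "cycle_normal_form (u, xs) = Some (u, xs)"
  | (cycle) "xs \<noteq> []" "chain xs" "length xs = n (hd xs)"
      "cycle_normal_form (u, xs) = Some (u, full_cycle (out_arc u))"
  | (not_chain) "\<not> chain xs" "cycle_normal_form (u, xs) = None"
  | (long) "xs \<noteq> []" "chain xs" "n (hd xs) < length xs" "cycle_normal_form (u, xs) = None"
  by (cases "xs = []"; cases "chain xs"; cases "length xs < n (hd xs)"; cases "length xs = n (hd xs)")
    (simp_all add: cycle_normal_form_def)

lemma cycle_normal_form_cycle:
  "a \<in> arcs G \<Longrightarrow> cycle_normal_form (u, full_cycle a) = Some (u, full_cycle (out_arc u))"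
  using period_pos[of a] by (simp add: cycle_normal_form_def chain_segment)

lemma cycle_normal_form_long:
  assumes "xs \<noteq> []" "n (hd xs) < length xs"
  shows "cycle_normal_form (u, xs) = None"
  using assms by (simp add: cycle_normal_form_def)

text \<open>The normal form alters full cycles only. These are closed walks, and the replacement is
  a closed walk at the same vertex, which is mapped to itself.\<close>

lemma cycle_normal_form_path:
  assumes "p \<in> paths G" "cycle_normal_form p = Some p'"
  shows "p' \<in> paths G \<and> fst p' = fst p \<and> path_end G p' = path_end G p \<and> cycle_normal_form p' = Some p'"
proof (cases "p' = p")
  case False
  obtain u xs where p: "p = (u, xs)" by (cases p)
  have xs: "xs \<noteq> []" "chain xs" "length xs = n (hd xs)" and p': "p' = (u, full_cycle (out_arc u))"
    using assms(2) False by (auto simp: cycle_normal_form_def p split: if_splits)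
  then have a: "hd xs \<in> arcs G" "u = tail G (hd xs)"
    using assms(1) by (auto simp: p in_paths_iff)
  have "xs = full_cycle (hd xs)"
    using chain_eq_segment[OF xs(2)] xs(3) by simp
  then have "path_end G p = u"
    using path_end_cycle[OF a(1)] a(2) p by simp
  moreover have b: "out_arc u \<in> arcs G" "tail G (out_arc u) = u"
    using out_arc a by auto
  ultimately show ?thesis
    using segment_in_paths[OF b(1), of "n (out_arc u)"] path_end_cycle[OF b(1)] b(2)
      cycle_normal_form_cycle[OF b(1), of u]
    by (simp add: p p')
qed (use assms in auto)

text \<open>The critical case is a full cycle \<open>xs\<close> followed by a nonempty
  \<open>ys\<close>. Exchanging the cycle for another one at the same vertex may change the period,
  but before and after the exchange the path is longer than the period of its head, so both sides
  are \<open>None\<close>.\<close>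

lemma cycle_normal_form_append_left:
  assumes path: "(u, xs @ ys) \<in> paths G"
  shows "cycle_normal_form (u, xs @ ys) =
    Option.bind (cycle_normal_form (u, xs)) (\<lambda>p. cycle_normal_form (u, snd p @ ys))"
proof -
  let ?N = cycle_normal_form
  have xs_path: "(u, xs) \<in> paths G"
    using path by (simp add: append_in_paths_iff)
  have arcs: "set (xs @ ys) \<subseteq> arcs G"
    using arcs_of_path[OF path] .
  consider "xs = []" | "ys = []" | "xs \<noteq> []" "ys \<noteq> []" by blast
  then show ?thesis
  proof cases
    case 1
    then show ?thesis by (simp add: cycle_normal_form_def)
  next
    case 2
    \<comment> \<open>With nothing appended the law is idempotence of the normal form.\<close>
    then show ?thesis
      using cycle_normal_form_path[OF xs_path] by (cases "?N (u, xs)") force+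
  next
    case 3
    have a: "hd xs \<in> arcs G" "out_arc u \<in> arcs G"
      using 3 arcs xs_path out_arc[of u] fst_in_verts[OF xs_path] by auto
    have cyc: "?N (u, full_cycle (out_arc u) @ ys) = None"
      using 3 arcs a set_segment[OF a(2)] period_pos[OF a(2)]
      by (intro cycle_normal_form_long) (auto simp: hd_append)
    show ?thesis
    proof (cases u xs rule: cycle_normal_form_cases)
      case cycle
      then have "?N (u, xs @ ys) = None"
        using 3 arcs by (intro cycle_normal_form_long) auto
      with cycle cyc show ?thesis by simp
    next
      case not_chain
      then have "?N (u, xs @ ys) = None"
        using 3 by (simp add: cycle_normal_form_def successively_append_iff)
      with not_chain show ?thesis by simp
    next
      case long
      then have "?N (u, xs @ ys) = None"
        using 3 arcs by (intro cycle_normal_form_long) auto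
      with long show ?thesis by simp
    qed simp
  qed
qed

text \<open>Unlike for left factors, the period is now measured at the head of \<open>xs\<close>,
  whereas the case distinction concerns \<open>ys\<close>. If the whole list is a chain,
  \<open>period_hd_append\<close> identifies the two periods; otherwise the result is
  \<open>None\<close> anyway.\<close>

lemma cycle_normal_form_append_right:
  assumes path: "(u, xs @ ys) \<in> paths G"
  shows "cycle_normal_form (u, xs @ ys) =
    Option.bind (cycle_normal_form (path_end G (u, xs), ys)) (\<lambda>q. cycle_normal_form (u, xs @ snd q))"
proof -
  let ?N = cycle_normal_form and ?v = "path_end G (u, xs)"
  have ys_path: "(?v, ys) \<in> paths G"
    using path by (simp add: append_in_paths_iff)
  have arcs: "set (xs @ ys) \<subseteq> arcs G"
    using arcs_of_path[OF path] .
  \<comment> \<open>The weak inequality is enough, since the nonempty \<open>xs\<close> pushes the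
    total length beyond the period. Full cycles \<open>zs\<close> are therefore included.\<close>
  have long: "?N (u, xs @ zs) = None"
    if "set zs \<subseteq> arcs G" "zs \<noteq> []" "n (hd zs) \<le> length zs" "xs \<noteq> []" for zs
  proof (cases "chain (xs @ zs)")
    case True
    with that arcs have "n (hd (xs @ zs)) = n (hd zs)"
      by (intro period_hd_append) auto
    then show ?thesis
      using that arcs by (intro cycle_normal_form_long) (auto simp: neq_Nil_conv)
  next
    case False
    then show ?thesis
      using that by (simp add: cycle_normal_form_def)
  qed
  consider "xs = []" | "ys = []" | "xs \<noteq> []" "ys \<noteq> []" by blast
  then show ?thesis
  proof cases
    case 1
    then show ?thesis
      using cycle_normal_form_path[OF ys_path] by (cases "?N (u, ys)") force+
  next
    case 2
    then show ?thesis by (simp add: cycle_normal_form_def)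
  next
    case 3
    have b: "out_arc ?v \<in> arcs G"
      using out_arc fst_in_verts[OF ys_path] by simp
    have cyc: "?N (u, xs @ full_cycle (out_arc ?v)) = None"
      using 3 set_segment[OF b] period_pos[OF b] by (intro long) auto
    show ?thesis
    proof (cases ?v ys rule: cycle_normal_form_cases)
      case cycle
      then show ?thesis
        using long[of ys] 3 arcs cyc by simp
    next
      case not_chain
      then have "?N (u, xs @ ys) = None"
        using 3 by (simp add: cycle_normal_form_def successively_append_iff)
      with not_chain show ?thesis by simp
    next
      case c: long
      then show ?thesis
        using long[of ys] 3 arcs by simp
    qed simp
  qed
qed

sublocale nf: normal_form G cycle_normal_form
  using cycle_normal_form_path cycle_normal_form_append_left cycle_normal_form_append_right
  by unfold_locales

text \<open>A cyclic permutation of a cycle is recorded by the arrow with which it starts, so arrows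
  index all rotations.\<close>

definition cycles :: "('a, 'b) qpath set" where
  "cycles = (\<lambda>a. (tail G a, full_cycle a)) ` arcs G"

lemma cycles_subset_paths: "cycles \<subseteq> paths G"
  by (auto simp: cycles_def segment_in_paths)

lemma cycle_normal_form_cycles:
  "C \<in> cycles \<Longrightarrow> cycle_normal_form C = Some (fst C, full_cycle (out_arc (fst C)))"
  by (auto simp: cycles_def cycle_normal_form_cycle)

text \<open>Has the shape of \<open>star_relations\<close>, so that identifying the two sets of
  cycles identifies the two ideals.\<close>

definition cycle_relations :: "(('a, 'b) qpath \<Rightarrow>\<^sub>0 'k::field) set" where
  "cycle_relations =
     {path_elem C - path_elem C' | C C'. C \<in> cycles \<and> C' \<in> cycles \<and> fst C = fst C'} \<union>
     {path_elem C \<otimes>\<^bsub>path_algebra G\<^esub> arrow_elem G (hd (snd C)) | C. C \<in> cycles} \<union>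
     {arrow_elem G a \<otimes>\<^bsub>path_algebra G\<^esub> arrow_elem G b | a b.
        a \<in> arcs G \<and> b \<in> arcs G \<and> \<not> (\<exists>C\<in>cycles. sublist [a, b] (snd C))}"

text \<open>The rotation starting at \<open>a\<close> begins with \<open>a\<close> and its
  successor, so the pair that wraps around a cycle needs no special treatment. Period 1 is the
  exception: the cycle is a loop without subpaths of length 2, although the loop is its own
  successor.\<close>

lemma sublist_cycles_iff:
  assumes "a \<in> arcs G"
  shows "(\<exists>C\<in>cycles. sublist [a, b] (snd C)) \<longleftrightarrow> b = \<sigma> a \<and> 2 \<le> n a"
proof
  assume "\<exists>C\<in>cycles. sublist [a, b] (snd C)"
  then obtain c ps ss where c: "c \<in> arcs G" and eq: "full_cycle c = ps @ [a, b] @ ss"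
    by (auto simp: cycles_def sublist_def)
  then have "b = \<sigma> a" and "n (hd (ps @ [a, b] @ ss)) = n (hd ([a, b] @ ss))"
    using chain_segment[of c "n c"] set_segment[OF c, of "n c"] period_hd_append[of ps "[a, b] @ ss"]
    by (auto simp: successively_append_iff)
  then show "b = \<sigma> a \<and> 2 \<le> n a"
    using arg_cong[OF eq, of length] arg_cong[OF eq, of hd] period_pos[OF c] by simp
next
  assume *: "b = \<sigma> a \<and> 2 \<le> n a"
  then have "full_cycle a = [a, b] @ drop 2 (full_cycle a)"
    by (intro nth_equalityI) (auto simp: nth_segment nth_append nth_Cons split: nat.split)
  then have "sublist [a, b] (full_cycle a)"
    by (metis sublist_appendI append_Nil)
  then show "\<exists>C\<in>cycles. sublist [a, b] (snd C)"
    using assms by (auto simp: cycles_def)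
qed

lemma cycle_relations_subset_kernel: "cycle_relations \<subseteq> (nf.kernel :: (_ \<Rightarrow>\<^sub>0 'k::field) set)"
proof -
  have zero: "(0 :: _ \<Rightarrow>\<^sub>0 'k) \<in> nf.kernel"
    by (simp add: nf.kernel_def)
  have elem: "(path_elem p :: _ \<Rightarrow>\<^sub>0 'k) \<in> nf.kernel"
    if "p \<in> paths G" "cycle_normal_form p = None" for p
    using that by (simp add: nf.kernel_def nf.reduce_term_def)
  have "(path_elem C - path_elem C' :: _ \<Rightarrow>\<^sub>0 'k) \<in> nf.kernel"
    if "C \<in> cycles" "C' \<in> cycles" "fst C = fst C'" for C C'
  proof -
    have "Poly_Mapping.keys (path_elem C - path_elem C' :: _ \<Rightarrow>\<^sub>0 'k) \<subseteq> paths G"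
      using cycles_subset_paths that by (intro keys_diff_subset) auto
    moreover have "cycle_normal_form C = cycle_normal_form C'"
      using that by (simp add: cycle_normal_form_cycles)
    ultimately show ?thesis
      by (simp add: nf.kernel_def nf.reduce_diff nf.reduce_term_def)
  qed
  moreover have "path_mult G (path_elem C) (arrow_elem G (hd (snd C)) :: _ \<Rightarrow>\<^sub>0 'k) \<in> nf.kernel"
    if C: "C \<in> cycles" for C
  proof -
    obtain a where a: "a \<in> arcs G" and C: "C = (tail G a, full_cycle a)"
      using C by (auto simp: cycles_def)
    have "path_mult G (path_elem C) (arrow_elem G (hd (snd C)) :: _ \<Rightarrow>\<^sub>0 'k) =
        path_elem (tail G a, full_cycle a @ [a])"
      using period_pos[OF a] path_end_cycle[OF a] by (simp add: C path_mult_single comp_term_def)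
    moreover have "cycle_normal_form (tail G a, full_cycle a @ [a]) = None"
      using a set_segment[OF a] period_pos[OF a]
      by (intro cycle_normal_form_long) (auto simp: hd_append)
    ultimately show ?thesis
      using elem[of "(tail G a, full_cycle a @ [a])"] segment_in_paths[OF a] path_end_cycle[OF a] a
      by (simp add: append_in_paths_iff arc_in_paths)
  qed
  moreover have "path_mult G (arrow_elem G a) (arrow_elem G b :: _ \<Rightarrow>\<^sub>0 'k) \<in> nf.kernel"
    if "a \<in> arcs G" "b \<in> arcs G" "\<not> (\<exists>C\<in>cycles. sublist [a, b] (snd C))" for a b
  proof (cases "head G a = tail G b")
    case True
    \<comment> \<open>Either \<open>[a, b]\<close> is not a chain, or \<open>n a = 1\<close> and two
      arrows are already too many.\<close>
    have "cycle_normal_form (tail G a, [a, b]) = None"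
      using that period_pos[OF that(1)] unfolding sublist_cycles_iff[OF that(1)]
      by (auto simp: cycle_normal_form_def)
    then show ?thesis
      using elem[of "(tail G a, [a, b])"] that True
      by (simp add: path_mult_single comp_term_def path_end_conv Cons_in_paths_iff)
  next
    case False
    then show ?thesis
      using zero by (simp add: path_mult_single comp_term_def path_end_conv)
  qed
  ultimately show ?thesis
    unfolding cycle_relations_def path_algebra_simps by blast
qed

text \<open>Each way in which a path can differ from its normal form is covered by one type of
  relation: full cycles by type 1, overlong chains by type 2, paths that are not chains by type
  3.\<close>

lemma genideal_cycle_relations:
  "Idl\<^bsub>path_algebra G\<^esub> cycle_relations = (nf.kernel :: (_ \<Rightarrow>\<^sub>0 'k::field) set)"
proof (rule nf.genideal_eq_kernel[OF cycle_relations_subset_kernel])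
  interpret R: ring "path_algebra G :: (('a,'b) qpath \<Rightarrow>\<^sub>0 'k) ring"
    by (rule ring_path_algebra)
  have carr: "cycle_relations \<subseteq> carrier (path_algebra G :: (('a,'b) qpath \<Rightarrow>\<^sub>0 'k) ring)"
    using cycle_relations_subset_kernel unfolding nf.kernel_def by blast
  let ?I = "Idl\<^bsub>path_algebra G\<^esub> cycle_relations :: (('a,'b) qpath \<Rightarrow>\<^sub>0 'k) set"
  interpret I: ideal ?I "path_algebra G :: (('a,'b) qpath \<Rightarrow>\<^sub>0 'k) ring"
    by (rule R.genideal_ideal[OF carr])
  fix p assume p: "p \<in> paths G"
  obtain u xs where u: "p = (u, xs)" by (cases p)
  have arcs: "set xs \<subseteq> arcs G"
    using arcs_of_path p u by blast
  show "path_elem p - nf.reduce_term p 1 \<in> ?I"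
  proof (cases u xs rule: cycle_normal_form_cases)
    case normal
    then show ?thesis
      using I.zero_closed by (simp add: u nf.reduce_term_def)
  next
    case cycle
    then have a: "hd xs \<in> arcs G" "u = tail G (hd xs)"
      using p arcs by (auto simp: u in_paths_iff)
    then have "p \<in> cycles"
      using chain_eq_segment[of xs] cycle by (auto simp: cycles_def u)
    moreover have "(u, full_cycle (out_arc u)) \<in> cycles"
      using out_arc[of u] fst_in_verts[OF p]
      by (auto simp: u cycles_def intro!: image_eqI[of _ _ "out_arc u"])
    ultimately have "path_elem p - path_elem (u, full_cycle (out_arc u)) \<in> (cycle_relations :: (_ \<Rightarrow>\<^sub>0 'k) set)"
      unfolding cycle_relations_def by (force simp: u)
    then show ?thesis
      using R.genideal_self[OF carr] cycle(4) by (auto simp: u nf.reduce_term_def)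
  next
    case not_chain
    then obtain as a b bs where xs: "xs = as @ [a, b] @ bs" and "b \<noteq> \<sigma> a"
      using not_successivelyD by blast
    then have ab: "a \<in> arcs G" "b \<in> arcs G" "\<not> (\<exists>C\<in>cycles. sublist [a, b] (snd C))"
      using arcs by (simp_all add: sublist_cycles_iff)
    then have "arrow_elem G a \<otimes>\<^bsub>path_algebra G\<^esub> arrow_elem G b \<in> ?I"
      using R.genideal_self[OF carr] unfolding cycle_relations_def by blast
    moreover have "head G a = tail G b" "path_end G (u, as) = tail G a"
      using p by (simp_all add: u xs append_in_paths_iff Cons_in_paths_iff)
    ultimately have "path_elem (path_end G (u, as), [a, b]) \<in> ?I"
      by (simp add: path_mult_single comp_term_def path_end_conv)
    then have "path_elem p \<in> ?I"
      using p path_elem_in_ideal[OF I.ideal_axioms, of u as "[a, b]" bs] by (simp add: u xs)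
    then show ?thesis
      using not_chain by (simp add: u nf.reduce_term_def)
  next
    case long
    let ?a = "hd xs"
    have a: "?a \<in> arcs G" "u = tail G ?a"
      using p arcs long by (auto simp: u in_paths_iff)
    \<comment> \<open>An overlong chain returns to its first arrow after \<open>n ?a\<close> steps,
      so its initial piece with one more arrow is a relation of type 2.\<close>
    have "take (Suc (n ?a)) xs = full_cycle ?a @ [?a]"
      using long(3) funpow_period[OF a(1)] nth_chain[OF long(2)]
      by (intro nth_equalityI) (auto simp: nth_append nth_segment less_Suc_eq)
    then have xs: "xs = [] @ (full_cycle ?a @ [?a]) @ drop (Suc (n ?a)) xs"
      by (metis append_take_drop_id append_Nil)
    have "(tail G ?a, full_cycle ?a) \<in> cycles"
      using a by (simp add: cycles_def)
    then have "path_elem (tail G ?a, full_cycle ?a) \<otimes>\<^bsub>path_algebra G\<^esub>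
        arrow_elem G (hd (snd (tail G ?a, full_cycle ?a))) \<in> ?I"
      using R.genideal_self[OF carr] unfolding cycle_relations_def by blast
    then have "path_elem (path_end G (u, []), full_cycle ?a @ [?a]) \<in> ?I"
      using period_pos[OF a(1)] path_end_cycle[OF a(1)] a(2)
      by (simp add: path_mult_single comp_term_def)
    moreover have "(u, [] @ (full_cycle ?a @ [?a]) @ drop (Suc (n ?a)) xs) \<in> paths G"
      using p xs u by metis
    ultimately have "path_elem (u, [] @ (full_cycle ?a @ [?a]) @ drop (Suc (n ?a)) xs) \<in> ?I"
      by (intro path_elem_in_ideal[OF I.ideal_axioms])
    then have "path_elem p \<in> ?I"
      using xs u by metis
    then show ?thesis
      using long by (simp add: u nf.reduce_term_def)
  qed
qed

text \<open>The range of \<open>k\<close> leaves out 0 and \<open>n a\<close>: trivial paths and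
  full cycles are counted once per vertex, not once per arrow.\<close>

lemma normal_paths_eq:
  "nf.normal_paths = (\<lambda>v. (v, [])) ` verts G \<union> (\<lambda>v. (v, full_cycle (out_arc v))) ` verts G \<union>
     (\<lambda>(a, k). (tail G a, segment a k)) ` (SIGMA a:arcs G. {1..<n a})"
proof (intro equalityI subsetI)
  fix p assume p: "p \<in> nf.normal_paths"
  obtain u xs where u: "p = (u, xs)" by (cases p)
  have path: "(u, xs) \<in> paths G" and nf: "cycle_normal_form (u, xs) = Some (u, xs)"
    using p by (simp_all add: u nf.normal_paths_def)
  have v: "u \<in> verts G"
    using fst_in_verts[OF path] by simp
  consider "xs = []" | "xs = full_cycle (out_arc u)" | "xs \<noteq> []" "chain xs" "length xs < n (hd xs)"
    using nf by (auto simp: cycle_normal_form_def split: if_splits)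
  then show "p \<in> (\<lambda>v. (v, [])) ` verts G \<union> (\<lambda>v. (v, full_cycle (out_arc v))) ` verts G \<union>
     (\<lambda>(a, k). (tail G a, segment a k)) ` (SIGMA a:arcs G. {1..<n a})"
  proof cases
    case 3
    then have "hd xs \<in> arcs G" "u = tail G (hd xs)"
      using path by (auto simp: in_paths_iff)
    then have "(u, xs) = (\<lambda>(a, k). (tail G a, segment a k)) (hd xs, length xs)"
      and "(hd xs, length xs) \<in> (SIGMA a:arcs G. {1..<n a})"
      using 3 chain_eq_segment[of xs] by (simp_all add: Suc_le_eq)
    then show ?thesis
      unfolding u by blast
  qed (use v u in auto)
next
  fix p
  assume "p \<in> (\<lambda>v. (v, [])) ` verts G \<union> (\<lambda>v. (v, full_cycle (out_arc v))) ` verts G \<union>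
     (\<lambda>(a, k). (tail G a, segment a k)) ` (SIGMA a:arcs G. {1..<n a})"
  then consider v where "v \<in> verts G" "p = (v, [])" | v where "v \<in> verts G" "p = (v, full_cycle (out_arc v))"
    | a k where "a \<in> arcs G" "1 \<le> k" "k < n a" "p = (tail G a, segment a k)"
    by auto
  then show "p \<in> nf.normal_paths"
  proof cases
    case 1
    then show ?thesis by (simp add: nf.normal_paths_def cycle_normal_form_def)
  next
    case 2
    then show ?thesis
      using out_arc[of v] segment_in_paths[of "out_arc v" "n (out_arc v)"] cycle_normal_form_cycle[of "out_arc v" v]
      by (simp add: nf.normal_paths_def)
  next
    case 3
    then show ?thesis
      using segment_in_paths[of a k] by (simp add: nf.normal_paths_def cycle_normal_form_def chain_segment)
  qed
qed

lemma finite_normal_paths: "finite nf.normal_paths"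
  unfolding normal_paths_eq by (intro finite_UnI finite_imageI finite_SigmaI) auto

lemma card_normal_paths: "card nf.normal_paths = 2 * card (verts G) + (\<Sum>a\<in>arcs G. n a - 1)"
proof -
  let ?E = "(\<lambda>v. (v, [])) ` verts G" and ?Z = "(\<lambda>v. (v, full_cycle (out_arc v))) ` verts G"
    and ?S = "(\<lambda>(a, k). (tail G a, segment a k)) ` (SIGMA a:arcs G. {1..<n a})"
  have fin: "finite ?E" "finite ?Z" "finite ?S" by auto
  have cyc: "n (out_arc v) \<noteq> 0" if "v \<in> verts G" for v
    using out_arc[OF that] period_pos[of "out_arc v"] by simp
  have "?E \<inter> ?Z = {}"
    by (auto simp: cyc)
  moreover have "(?E \<union> ?Z) \<inter> ?S = {}"
  proof -
    have "segment a k \<noteq> []" "segment a k \<noteq> full_cycle (out_arc v)"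
      if "a \<in> arcs G" "1 \<le> k" "k < n a" "v \<in> verts G" for a k v
    proof -
      show "segment a k \<noteq> full_cycle (out_arc v)"
      proof
        assume eq: "segment a k = full_cycle (out_arc v)"
        then have "a = out_arc v \<and> k = n (out_arc v)"
          using that(2) by (intro segment_eqD) auto
        then show False using that by simp
      qed
    qed (use that in auto)
    then show ?thesis by auto
  qed
  moreover have "inj_on (\<lambda>(a, k). (tail G a, segment a k)) (SIGMA a:arcs G. {1..<n a})"
  proof (rule inj_onI, clarsimp)
    fix a k a' k'
    assume "segment a k = segment a' k'" and "Suc 0 \<le> k"
    then show "a = a' \<and> k = k'"
      by (intro segment_eqD) auto
  qed
  then have "card ?S = (\<Sum>a\<in>arcs G. n a - 1)"
    by (simp add: card_image card_SigmaI)
  moreover have "card ?E = card (verts G)" "card ?Z = card (verts G)"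
    by (simp_all add: card_image inj_on_def)
  ultimately show ?thesis
    using fin by (simp add: normal_paths_eq card_Un_disjoint)
qed

lemma quot_dim_cycle_relations:
  assumes "verts G \<noteq> {}"
  shows "quot_finite_dim G (Idl\<^bsub>path_algebra G\<^esub> cycle_relations :: (_ \<Rightarrow>\<^sub>0 'k::field) set)"
    and "quot_dim G (Idl\<^bsub>path_algebra G\<^esub> cycle_relations :: (_ \<Rightarrow>\<^sub>0 'k) set) =
      2 * card (verts G) + (\<Sum>a\<in>arcs G. n a - 1)"
proof -
  have "nf.normal_paths \<noteq> {}"
    using assms by (auto simp: normal_paths_eq)
  from nf.quot_dim_kernel[OF finite_normal_paths this, where ?'k = 'k]
  show "quot_finite_dim G (Idl\<^bsub>path_algebra G\<^esub> cycle_relations :: (_ \<Rightarrow>\<^sub>0 'k) set)"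
    and "quot_dim G (Idl\<^bsub>path_algebra G\<^esub> cycle_relations :: (_ \<Rightarrow>\<^sub>0 'k) set) =
      2 * card (verts G) + (\<Sum>a\<in>arcs G. n a - 1)"
    by (simp_all add: genideal_cycle_relations card_normal_paths)
qed

end

section \<open>Almost gentle algebras\<close>

lemma successively_conj:
  "successively (\<lambda>a b. P a b \<and> Q a b) xs \<longleftrightarrow> successively P xs \<and> successively Q xs"
  by (auto simp: successively_conv_nth)

locale almost_gentle_presentation = fin_digraph Q
  for Q :: "('v, 'a) pre_digraph" and I :: "(('v, 'a) qpath \<Rightarrow>\<^sub>0 'k::field) set" +
  assumes almost_gentle: "almost_gentle Q I"
begin

text \<open>The hypothesis merely asserts that some generating set of paths of length 2 exists. All
  such paths in \<open>I\<close> form a canonical one: it contains the given set and lies in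
  \<open>I\<close>.\<close>

definition relation_paths :: "('v, 'a) qpath set" where
  "relation_paths = {p \<in> paths Q. path_length p = 2 \<and> path_elem p \<in> I}"

sublocale quadratic_monomial Q relation_paths
  by unfold_locales (auto simp: relation_paths_def)

lemma genideal_relation_paths: "Idl\<^bsub>path_algebra Q\<^esub> (path_elem ` relation_paths) = I"
proof -
  interpret R: ring "path_algebra Q :: (('v,'a) qpath \<Rightarrow>\<^sub>0 'k) ring"
    by (rule ring_path_algebra)
  obtain P where P: "P \<subseteq> {p \<in> paths Q. path_length p = 2}" and I: "I = Idl\<^bsub>path_algebra Q\<^esub> (path_elem ` P)"
    and ideal: "ideal I (path_algebra Q)"
    using almost_gentle by (auto simp: almost_gentle_def admissible_def)
  have "path_elem ` P \<subseteq> carrier (path_algebra Q :: (('v,'a) qpath \<Rightarrow>\<^sub>0 'k) ring)"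
    using P by auto
  then have "path_elem ` P \<subseteq> I"
    unfolding I by (rule R.genideal_self)
  then have "path_elem ` P \<subseteq> (path_elem ` relation_paths :: (_ \<Rightarrow>\<^sub>0 'k) set)"
    using P by (auto simp: relation_paths_def)
  moreover have carr: "path_elem ` relation_paths \<subseteq> carrier (path_algebra Q :: (('v,'a) qpath \<Rightarrow>\<^sub>0 'k) ring)"
    by (auto simp: relation_paths_def)
  ultimately have "Idl\<^bsub>path_algebra Q\<^esub> (path_elem ` P)
      \<subseteq> Idl\<^bsub>path_algebra Q\<^esub> (path_elem ` relation_paths :: (_ \<Rightarrow>\<^sub>0 'k) set)"
    using R.genideal_self[OF carr]
    by (intro R.genideal_minimal[OF R.genideal_ideal[OF carr]]) (rule order.trans)
  then have "I \<subseteq> Idl\<^bsub>path_algebra Q\<^esub> (path_elem ` relation_paths)"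
    by (rule ord_eq_le_trans[OF I])
  moreover have "Idl\<^bsub>path_algebra Q\<^esub> (path_elem ` relation_paths) \<subseteq> I"
    by (rule R.genideal_minimal[OF ideal]) (auto simp: relation_paths_def)
  ultimately show ?thesis by blast
qed

lemma path_elem_in_I_iff: "p \<in> paths Q \<Longrightarrow> path_elem p \<in> I \<longleftrightarrow> \<not> nonzero_path p"
  using path_elem_in_genideal_iff[where ?'k = 'k] by (simp add: genideal_relation_paths)

definition follows :: "'a \<Rightarrow> 'a \<Rightarrow> bool" where
  "follows a b \<longleftrightarrow> a \<in> arcs Q \<and> b \<in> arcs Q \<and> head Q a = tail Q b \<and> (tail Q a, [a, b]) \<notin> relation_paths"

text \<open>Arrows that do not compose have product 0, which lies in \<open>I\<close>. The
  uniqueness in (S1) is therefore uniqueness for \<open>follows\<close> in both directions.\<close>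

lemma follows_iff:
  assumes "a \<in> arcs Q" "b \<in> arcs Q"
  shows "follows a b \<longleftrightarrow> arrow_elem Q a \<otimes>\<^bsub>path_algebra Q\<^esub> arrow_elem Q b \<notin> I"
proof (cases "head Q a = tail Q b")
  case True
  then show ?thesis
    using assms path_elem_in_I_iff[of "(tail Q a, [a, b])"]
    by (simp add: follows_def nonzero_path_def path_mult_single comp_term_def path_end_conv Cons_in_paths_iff)
next
  case False
  interpret R: ring "path_algebra Q :: (('v,'a) qpath \<Rightarrow>\<^sub>0 'k) ring"
    by (rule ring_path_algebra)
  have "ideal I (path_algebra Q)"
    using almost_gentle by (auto simp: almost_gentle_def admissible_def)
  then interpret I: ideal I "path_algebra Q :: (('v,'a) qpath \<Rightarrow>\<^sub>0 'k) ring" .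
  show ?thesis
    using False I.zero_closed by (simp add: follows_def path_mult_single comp_term_def path_end_conv)
qed

text \<open>Composability and avoidance of relations are both conditions on adjacent arrows and
  merge into one relation; nontrivial nonzero paths become chains.\<close>

lemma nonzero_path_iff:
  "(u, p) \<in> paths Q \<and> nonzero_path (u, p) \<longleftrightarrow>
     (if p = [] then u \<in> verts Q else u = tail Q (hd p) \<and> set p \<subseteq> arcs Q \<and> successively follows p)"
proof -
  have "successively follows p \<longleftrightarrow> successively (\<lambda>a b. head Q a = tail Q b) p \<and> nonzero_path (u, p)"
    if "set p \<subseteq> arcs Q"
    unfolding nonzero_path_def snd_conv successively_conj[symmetric]
    using that by (intro successively_cong) (auto simp: follows_def)
  then show ?thesis
    by (auto simp: in_paths_iff nonzero_path_def)
qed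

text \<open>A fixed choice of exponent, since the interpretation of \<open>bounded_chains\<close>
  needs a term for its bound.\<close>

definition nilpotency_bound :: nat where
  "nilpotency_bound = (SOME n. 2 \<le> n \<and> arrow_ideal_pow Q n \<subseteq> I)"

lemma arrow_ideal_pow_nilpotency_bound:
  "2 \<le> nilpotency_bound \<and> arrow_ideal_pow Q nilpotency_bound \<subseteq> I"
proof -
  obtain n where "2 \<le> n \<and> arrow_ideal_pow Q n \<subseteq> I"
    using almost_gentle unfolding almost_gentle_def admissible_def by blast
  then show ?thesis
    unfolding nilpotency_bound_def by (rule someI)
qed

text \<open>Induction from the right end, because the powers are built by multiplying with the arrow
  ideal on the right.\<close>

lemma path_elem_in_arrow_ideal_pow:
  "(u, p) \<in> paths Q \<Longrightarrow> path_elem (u, p) \<in> (arrow_ideal_pow Q (length p) :: (_ \<Rightarrow>\<^sub>0 'k) set)"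
proof (induction p rule: rev_induct)
  case (snoc a p)
  interpret R: ring "path_algebra Q :: (('v,'a) qpath \<Rightarrow>\<^sub>0 'k) ring"
    by (rule ring_path_algebra)
  have path: "(u, p) \<in> paths Q" "a \<in> arcs Q" "path_end Q (u, p) = tail Q a"
    using snoc.prems by (simp_all add: append_in_paths_iff Cons_in_paths_iff)
  have "arrow_elem Q ` arcs Q \<subseteq> carrier (path_algebra Q :: (('v,'a) qpath \<Rightarrow>\<^sub>0 'k) ring)"
    by (auto simp: arc_in_paths)
  then have "arrow_elem Q a \<in> (arrow_ideal Q :: (_ \<Rightarrow>\<^sub>0 'k) set)"
    using R.genideal_self path(2) unfolding arrow_ideal_def by blast
  with snoc.IH[OF path(1)]
  have "path_elem (u, p) \<otimes>\<^bsub>path_algebra Q\<^esub> arrow_elem Q a \<in> (arrow_ideal_pow Q (Suc (length p)) :: (_ \<Rightarrow>\<^sub>0 'k) set)"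
    unfolding arrow_ideal_pow.simps by (rule ideal_prod.prod)
  then show ?case
    using path(3) by (simp add: path_mult_single comp_term_def)
qed simp

text \<open>Uniqueness on both sides is (S1). The bound is admissibility: a chain with too many
  arrows would contain a nonzero path lying in \<open>I\<close>.\<close>

sublocale bounded_chains "arcs Q" follows nilpotency_bound
proof
  show "finite (arcs Q)" by simp
next
  fix a b assume "follows a b"
  then show "a \<in> arcs Q \<and> b \<in> arcs Q" by (simp add: follows_def)
next
  fix a b c assume *: "follows a b" "follows a c"
  then have arcs: "a \<in> arcs Q" "b \<in> arcs Q" "c \<in> arcs Q" by (simp_all add: follows_def)
  have "\<exists>\<^sub>\<le>\<^sub>1 b. b \<in> arcs Q \<and> arrow_elem Q a \<otimes>\<^bsub>path_algebra Q\<^esub> arrow_elem Q b \<notin> I"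
    using almost_gentle arcs(1) unfolding almost_gentle_def by blast
  then show "b = c"
    using * follows_iff arcs by (auto simp only: Uniq_def)
next
  fix a b c assume *: "follows b a" "follows c a"
  then have arcs: "a \<in> arcs Q" "b \<in> arcs Q" "c \<in> arcs Q" by (simp_all add: follows_def)
  have "\<exists>\<^sub>\<le>\<^sub>1 c. c \<in> arcs Q \<and> arrow_elem Q c \<otimes>\<^bsub>path_algebra Q\<^esub> arrow_elem Q a \<notin> I"
    using almost_gentle arcs(1) unfolding almost_gentle_def by blast
  then show "b = c"
    using * follows_iff arcs by (auto simp only: Uniq_def)
next
  fix l assume l: "set l \<subseteq> arcs Q" "successively follows l"
  show "length l < nilpotency_bound"
  proof (rule ccontr)
    \<comment> \<open>Cutting to exactly \<open>nilpotency_bound\<close> arrows puts the path into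
      the power known to lie in \<open>I\<close>.\<close>
    let ?p = "take nilpotency_bound l" and ?u = "tail Q (hd l)"
    assume len: "\<not> length l < nilpotency_bound"
    have ne: "nilpotency_bound \<noteq> 0"
      using arrow_ideal_pow_nilpotency_bound by simp
    have "successively follows ?p" "set ?p \<subseteq> arcs Q" "?p \<noteq> []"
      using l len ne successively_append_iff[of follows ?p "drop nilpotency_bound l"] set_take_subset[of nilpotency_bound l]
      by auto
    then have p: "(?u, ?p) \<in> paths Q" "nonzero_path (?u, ?p)"
      using nonzero_path_iff[of ?u ?p] ne by (simp_all add: hd_take)
    have "length ?p = nilpotency_bound"
      using len by simp
    with path_elem_in_arrow_ideal_pow[OF p(1)] have "path_elem (?u, ?p) \<in> I"
      using arrow_ideal_pow_nilpotency_bound by auto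
    then show False
      using p path_elem_in_I_iff by blast
  qed
qed

end

section \<open>Maximal paths and the dimension of \<open>A\<close>\<close>

context almost_gentle_presentation
begin

lemma nonzero_paths_eq:
  "nf.normal_paths = (\<lambda>v. (v, [])) ` verts Q \<union> (\<lambda>l. (tail Q (hd l), l)) ` chains"
proof -
  have "p \<in> nf.normal_paths \<longleftrightarrow> p \<in> paths Q \<and> nonzero_path p" for p
    by (simp add: nf.normal_paths_def nonzero_normal_form_def)
  then have "(u, p) \<in> nf.normal_paths \<longleftrightarrow>
      (u, p) \<in> (\<lambda>v. (v, [])) ` verts Q \<union> (\<lambda>l. (tail Q (hd l), l)) ` chains" for u p
    using nonzero_path_iff[of u p] by (auto simp: chains_def)
  then show ?thesis
    by auto
qed

lemma finite_nonzero_paths: "finite nf.normal_paths"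
  unfolding nonzero_paths_eq using finite_chains by simp

lemma card_nonzero_paths: "card nf.normal_paths = card (verts Q) + card chains"
proof -
  have "(\<lambda>v. (v, [])) ` verts Q \<inter> (\<lambda>l. (tail Q (hd l), l)) ` chains = {}"
    by (auto simp: chains_def)
  moreover have "card ((\<lambda>v. (v, [] :: 'a list)) ` verts Q) = card (verts Q)"
    by (simp add: card_image inj_on_def)
  moreover have "card ((\<lambda>l. (tail Q (hd l), l)) ` chains) = card chains"
    by (simp add: card_image inj_on_def)
  ultimately show ?thesis
    using finite_chains by (simp add: nonzero_paths_eq card_Un_disjoint)
qed

text \<open>A product with an arrow lies in \<open>I\<close> if the two do not compose or if the
  longer path is zero, and the latter depends on the pair at the junction alone. For a trivial path
  the longer path is a single arrow, which is never zero, so maximality forces the vertex to be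
  isolated.\<close>

lemma maximal_paths_iff:
  "(u, p) \<in> maximal_paths Q I \<longleftrightarrow>
     (if p = [] then u \<in> verts Q \<and> (\<forall>a\<in>arcs Q. head Q a \<noteq> u \<and> tail Q a \<noteq> u)
      else u = tail Q (hd p) \<and> p \<in> max_chains)"
proof -
  interpret R: ring "path_algebra Q :: (('v,'a) qpath \<Rightarrow>\<^sub>0 'k) ring"
    by (rule ring_path_algebra)
  have "ideal I (path_algebra Q)"
    using almost_gentle by (auto simp: almost_gentle_def admissible_def)
  then interpret I: ideal I "path_algebra Q :: (('v,'a) qpath \<Rightarrow>\<^sub>0 'k) ring" .
  have zero: "0 \<in> I"
    using I.zero_closed by simp
  have nonzero: "path_elem q \<notin> I \<longleftrightarrow> nonzero_path q" if "q \<in> paths Q" for q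
    using path_elem_in_I_iff[OF that] by simp
  have pre: "path_mult Q (arrow_elem Q a) (path_elem (u, p)) \<in> I \<longleftrightarrow>
      \<not> (head Q a = u \<and> nonzero_path (tail Q a, a # p))"
    if "a \<in> arcs Q" "(u, p) \<in> paths Q" for a
    using that zero path_elem_in_I_iff[of "(tail Q a, a # p)"]
    by (auto simp: path_mult_single comp_term_def path_end_conv Cons_in_paths_iff)
  have post: "path_mult Q (path_elem (u, p)) (arrow_elem Q a) \<in> I \<longleftrightarrow>
      \<not> (path_end Q (u, p) = tail Q a \<and> nonzero_path (u, p @ [a]))"
    if "a \<in> arcs Q" "(u, p) \<in> paths Q" for a
    using that zero path_elem_in_I_iff[of "(u, p @ [a])"]
    by (auto simp: path_mult_single comp_term_def append_in_paths_iff Cons_in_paths_iff)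
  have iff: "(u, p) \<in> maximal_paths Q I \<longleftrightarrow> (u, p) \<in> paths Q \<and> nonzero_path (u, p) \<and>
      (\<forall>a\<in>arcs Q. \<not> (head Q a = u \<and> nonzero_path (tail Q a, a # p)) \<and>
        \<not> (path_end Q (u, p) = tail Q a \<and> nonzero_path (u, p @ [a])))"
    unfolding maximal_paths_def using nonzero pre post by auto
  show ?thesis
  proof (cases "p = []")
    case True
    then show ?thesis
      unfolding iff by (auto simp: nonzero_path_def)
  next
    case False
    have "(head Q a = u \<and> nonzero_path (tail Q a, a # p)) \<longleftrightarrow> follows a (hd p)"
      "(path_end Q (u, p) = tail Q a \<and> nonzero_path (u, p @ [a])) \<longleftrightarrow> follows (last p) a"
      if "a \<in> arcs Q" "(u, p) \<in> paths Q" "nonzero_path (u, p)" for a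
      using that False
      by (auto simp: nonzero_path_def successively_Cons successively_append_iff path_end_conv
          follows_def in_paths_iff)
    then have "(u, p) \<in> maximal_paths Q I \<longleftrightarrow> (u, p) \<in> paths Q \<and> nonzero_path (u, p) \<and>
        (\<forall>a\<in>arcs Q. \<not> follows a (hd p) \<and> \<not> follows (last p) a)"
      unfolding iff by blast
    also have "\<dots> \<longleftrightarrow> u = tail Q (hd p) \<and> p \<in> max_chains"
      using False s_in_X nonzero_path_iff[of u p] by (auto simp: max_chains_def chains_def)
    finally show ?thesis
      using False by simp
  qed
qed

lemma maximal_paths_eq:
  "maximal_paths Q I = (\<lambda>v. (v, [])) ` {v \<in> verts Q. \<forall>a\<in>arcs Q. head Q a \<noteq> v \<and> tail Q a \<noteq> v} \<union>
     (\<lambda>m. (tail Q (hd m), m)) ` max_chains"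
proof -
  have "[] \<notin> max_chains"
    by (simp add: max_chains_def chains_def)
  then have "(u, p) \<in> maximal_paths Q I \<longleftrightarrow>
      (u, p) \<in> (\<lambda>v. (v, [])) ` {v \<in> verts Q. \<forall>a\<in>arcs Q. head Q a \<noteq> v \<and> tail Q a \<noteq> v} \<union>
        (\<lambda>m. (tail Q (hd m), m)) ` max_chains" for u p
    unfolding maximal_paths_iff by auto
  then show ?thesis by auto
qed

lemma finite_maximal_paths: "finite (maximal_paths Q I)"
  unfolding maximal_paths_eq using finite_max_chains by simp

lemma maximal_paths_subset: "maximal_paths Q I \<subseteq> paths Q"
  by (auto simp: maximal_paths_def)

text \<open>Trivial maximal paths have length 0 and contribute nothing, so the sum may be taken over
  maximal chains.\<close>

lemma sum_maximal_paths:
  "(\<Sum>m\<in>maximal_paths Q I. path_length m * (path_length m + 1)) =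
     (\<Sum>m\<in>max_chains. length m * (length m + 1))"
proof -
  let ?E = "(\<lambda>v. (v, [])) ` {v \<in> verts Q. \<forall>a\<in>arcs Q. head Q a \<noteq> v \<and> tail Q a \<noteq> v}"
  have "(\<Sum>m\<in>maximal_paths Q I. path_length m * (path_length m + 1)) =
      (\<Sum>m\<in>(\<lambda>m. (tail Q (hd m), m)) ` max_chains. path_length m * (path_length m + 1))"
    unfolding maximal_paths_eq using finite_max_chains by (intro sum.mono_neutral_right) auto
  also have "\<dots> = (\<Sum>m\<in>max_chains. length m * (length m + 1))"
    by (subst sum.reindex) (auto simp: inj_on_def)
  finally show ?thesis .
qed

lemma quot_dim_eq:
  assumes "verts Q \<noteq> {}"
  shows "quot_finite_dim Q I"
    and "2 * quot_dim Q I =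
      2 * card (verts Q) + (\<Sum>m\<in>maximal_paths Q I. path_length m * (path_length m + 1))"
proof -
  have ne: "nf.normal_paths \<noteq> {}"
    using assms by (auto simp: nonzero_paths_eq)
  have kernel: "nf.kernel = I"
    using genideal_relation_paths genideal_eq_kernel[where ?'k = 'k] by simp
  note nf.quot_dim_kernel[OF finite_nonzero_paths ne, where ?'k = 'k, unfolded kernel]
  then show "quot_finite_dim Q I"
    and "2 * quot_dim Q I =
      2 * card (verts Q) + (\<Sum>m\<in>maximal_paths Q I. path_length m * (path_length m + 1))"
    unfolding sum_maximal_paths card_chains[symmetric] by (simp_all add: card_nonzero_paths)
qed

end

text \<open>With no vertex there is no path, the quotient is the zero ring, and that ring does not
  count as indecomposable.\<close>

lemma verts_nonempty_if_indecomposable: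
  assumes "fin_digraph Q" "indecomposable_ring (quot_algebra Q I)"
  shows "verts Q \<noteq> {}"
proof
  interpret fin_digraph Q by (rule assms(1))
  assume "verts Q = {}"
  then have "paths Q = {}"
    using fst_in_verts by blast
  then have "carrier (quot_algebra Q I) = {I +>\<^bsub>path_algebra Q\<^esub> 0}"
    unfolding quot_algebra_def quot_carrier_eq by simp
  moreover have "I +>\<^bsub>path_algebra Q\<^esub> 0 = \<zero>\<^bsub>quot_algebra Q I\<^esub>"
    by (simp add: quot_algebra_def FactRing_def a_r_coset_def r_coset_def)
  ultimately show False
    using assms(2) by (simp add: indecomposable_ring_def)
qed

section \<open>The cycles of the star quiver and the dimension of its quotient\<close>

context almost_gentle_presentation
begin

abbreviation star :: "('v, 'a + ('v, 'a) qpath) pre_digraph" where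
  "star \<equiv> star_quiver Q I"

abbreviation closing_arrows :: "('v, 'a) qpath \<Rightarrow> ('a + ('v, 'a) qpath) list" where
  "closing_arrows m \<equiv> snd (closing_cycle m)"

lemma star_simps [simp]:
  "verts star = verts Q" "arcs star = Inl ` arcs Q \<union> Inr ` maximal_paths Q I"
  "tail star (Inl a) = tail Q a" "tail star (Inr m) = path_end Q m"
  "head star (Inl a) = head Q a" "head star (Inr m) = fst m"
  by (simp_all add: star_quiver_def)

lemma length_closing_arrows [simp]: "length (closing_arrows m) = Suc (path_length m)"
  by (simp add: closing_cycle_def)

lemma nth_closing_arrows:
  "i \<le> path_length m \<Longrightarrow> closing_arrows m ! i = (if i < path_length m then Inl (snd m ! i) else Inr m)"
  by (simp add: closing_cycle_def nth_append)

lemma fin_digraph_star: "fin_digraph star"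
proof
  fix e assume "e \<in> arcs star"
  then show "tail star e \<in> verts star" "head star e \<in> verts star"
    using path_end_in_verts fst_in_verts maximal_paths_subset by auto
qed (use finite_maximal_paths in auto)

lemma maximal_path_arrows: "m \<in> maximal_paths Q I \<Longrightarrow> set (snd m) \<subseteq> arcs Q"
  using maximal_paths_subset arcs_of_path[of "fst m" "snd m"] by auto

lemma closing_arrows_subset: "m \<in> maximal_paths Q I \<Longrightarrow> set (closing_arrows m) \<subseteq> arcs star"
  using maximal_path_arrows[of m] by (auto simp: closing_cycle_def)

lemma ex_closing_arrows:
  assumes "x \<in> arcs star"
  shows "\<exists>m\<in>maximal_paths Q I. \<exists>i\<le>path_length m. x = closing_arrows m ! i"
proof -
  have "\<exists>m\<in>maximal_paths Q I. x \<in> set (closing_arrows m)"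
  proof (cases x)
    case (Inl a)
    then obtain m where "m \<in> max_chains" "a \<in> set m"
      using assms in_max_chain[of a] by auto
    then show ?thesis
      using Inl by (intro bexI[of _ "(tail Q (hd m), m)"]) (auto simp: maximal_paths_eq closing_cycle_def)
  next
    case (Inr m)
    then show ?thesis
      using assms by (auto simp: closing_cycle_def)
  qed
  then show ?thesis
    by (auto simp: in_set_conv_nth less_Suc_eq_le)
qed

text \<open>An old arrow occupies one position on one maximal path by
  \<open>max_chain_unique\<close>, and a new arrow carries its path as a label. Together with
  \<open>ex_closing_arrows\<close>, the arrows of \<open>star\<close> correspond to pairs
  \<open>(m, i)\<close> with \<open>i\<close> at most the length of \<open>m\<close>.\<close>

lemma closing_arrows_inject:
  assumes "m \<in> maximal_paths Q I" "i \<le> path_length m" "m' \<in> maximal_paths Q I" "j \<le> path_length m'"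
    and eq: "closing_arrows m ! i = closing_arrows m' ! j"
  shows "m = m' \<and> i = j"
proof (cases "i < path_length m")
  case True
  then have j: "j < path_length m'" and nth: "snd m ! i = snd m' ! j"
    using eq assms by (auto simp: nth_closing_arrows split: if_splits)
  have max: "snd m \<in> max_chains" "fst m = tail Q (hd (snd m))" "snd m' \<in> max_chains" "fst m' = tail Q (hd (snd m'))"
    using assms True j maximal_paths_iff[of "fst m" "snd m"] maximal_paths_iff[of "fst m'" "snd m'"]
    by (auto split: if_splits)
  note split = id_take_nth_drop[OF True] id_take_nth_drop[OF j, folded nth]
  have *: "take i (snd m) = take j (snd m') \<and> drop (Suc i) (snd m) = drop (Suc j) (snd m')"
    by (rule max_chain_unique[OF max(1,3) split])
  then have "snd m = snd m'"
    using split by metis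
  moreover have "i = j"
    using arg_cong[OF conjunct1[OF *], of length] True j by simp
  ultimately show ?thesis
    using max by (simp add: prod_eq_iff)
next
  case False
  then show ?thesis
    using assms by (auto simp: nth_closing_arrows split: if_splits)
qed

lemma head_closing_arrows:
  assumes "m \<in> maximal_paths Q I" "i \<le> path_length m"
  shows "head star (closing_arrows m ! i) = tail star (closing_arrows m ! (Suc i mod Suc (path_length m)))"
proof -
  obtain u p where m: "m = (u, p)" by (cases m)
  have path: "(u, p) \<in> paths Q"
    using assms maximal_paths_subset m by auto
  \<comment> \<open>In this order: the loop of a trivial path, the passage from the new arrow to the
    first old one, the passage onto the new arrow, and a passage inside \<open>m\<close>.\<close>
  consider "i = length p" "p = []" | "i = length p" "p \<noteq> []" | "Suc i = length p" | "Suc i < length p"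
    using assms(2) m by fastforce
  then show ?thesis
  proof cases
    case 1
    then show ?thesis by (simp add: m nth_closing_arrows)
  next
    case 2
    then show ?thesis
      using path by (simp add: m nth_closing_arrows in_paths_iff hd_conv_nth)
  next
    case 3
    then have "i = length p - 1" "p \<noteq> []" by auto
    then show ?thesis
      by (simp add: m nth_closing_arrows path_end_conv last_conv_nth)
  next
    case 4
    then have "successively (\<lambda>a b. head Q a = tail Q b) p"
      using path by (auto simp: in_paths_iff split: if_splits)
    then show ?thesis
      using 4 successively_nth[of _ p i] by (simp add: m nth_closing_arrows)
  qed
qed

text \<open>The cyclic shift along the cycle through \<open>x\<close>. By
  \<open>closing_arrows_inject\<close> the pair \<open>(m, i)\<close> is unique, which makes this
  description, and likewise \<open>period\<close>, well defined on arrows of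
  \<open>star\<close>.\<close>

definition successor :: "'a + ('v, 'a) qpath \<Rightarrow> 'a + ('v, 'a) qpath" where
  "successor x = (THE y. \<exists>m\<in>maximal_paths Q I. \<exists>i\<le>path_length m.
     x = closing_arrows m ! i \<and> y = closing_arrows m ! (Suc i mod Suc (path_length m)))"

definition period :: "'a + ('v, 'a) qpath \<Rightarrow> nat" where
  "period x = (THE k. \<exists>m\<in>maximal_paths Q I. \<exists>i\<le>path_length m.
     x = closing_arrows m ! i \<and> k = Suc (path_length m))"

lemma successor_closing_arrows:
  assumes "m \<in> maximal_paths Q I" "i \<le> path_length m"
  shows "successor (closing_arrows m ! i) = closing_arrows m ! (Suc i mod Suc (path_length m))"
  unfolding successor_def
proof (rule the_equality)
  fix y
  assume "\<exists>m'\<in>maximal_paths Q I. \<exists>j\<le>path_length m'. closing_arrows m ! i = closing_arrows m' ! j \<and>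
    y = closing_arrows m' ! (Suc j mod Suc (path_length m'))"
  then show "y = closing_arrows m ! (Suc i mod Suc (path_length m))"
    using closing_arrows_inject[OF assms] by blast
qed (use assms in blast)

lemma period_closing_arrows:
  assumes "m \<in> maximal_paths Q I" "i \<le> path_length m"
  shows "period (closing_arrows m ! i) = Suc (path_length m)"
  unfolding period_def
proof (rule the_equality)
  fix k
  assume "\<exists>m'\<in>maximal_paths Q I. \<exists>j\<le>path_length m'. closing_arrows m ! i = closing_arrows m' ! j \<and>
    k = Suc (path_length m')"
  then show "k = Suc (path_length m)"
    using closing_arrows_inject[OF assms] by blast
qed (use assms in blast)

lemma funpow_successor:
  assumes "m \<in> maximal_paths Q I" "i \<le> path_length m"
  shows "(successor ^^ k) (closing_arrows m ! i) = closing_arrows m ! ((i + k) mod Suc (path_length m))"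
proof (induction k)
  case (Suc k)
  have "(i + k) mod Suc (path_length m) \<le> path_length m"
    using mod_less_divisor[of "Suc (path_length m)" "i + k"] by simp
  with Suc show ?case
    by (simp add: successor_closing_arrows[OF assms(1)] mod_Suc_eq)
qed (use assms in simp)

text \<open>Ensures that each vertex has a full cycle to contribute. If no old arrow leaves
  \<open>v\<close> but some \<open>a\<close> enters it, the maximal path through \<open>a\<close>
  must stop at \<open>v\<close>, where its new arrow starts. An isolated vertex has the loop of its
  trivial maximal path.\<close>

lemma ex_star_arrow_from:
  assumes v: "v \<in> verts Q"
  shows "\<exists>x\<in>arcs star. tail star x = v"
proof (cases "\<exists>a\<in>arcs Q. tail Q a = v")
  case True
  then obtain a where "a \<in> arcs Q" "tail Q a = v" by blast
  then show ?thesis by (intro bexI[of _ "Inl a"]) auto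
next
  case no_out: False
  show ?thesis
  proof (cases "\<exists>a\<in>arcs Q. head Q a = v")
    case True
    then obtain a where a: "a \<in> arcs Q" "head Q a = v" by blast
    then obtain p where p: "p \<in> max_chains" "a \<in> set p"
      using in_max_chain by blast
    then obtain xs ys where eq: "p = xs @ a # ys"
      by (meson split_list)
    have "ys = []"
    proof (rule ccontr)
      assume "ys \<noteq> []"
      then have "follows a (hd ys)"
        using p by (auto simp: eq max_chains_def chains_def successively_append_iff successively_Cons)
      then show False
        using no_out a by (auto simp: follows_def)
    qed
    then have "path_end Q (tail Q (hd p), p) = v"
      using a by (simp add: path_end_conv eq)
    then show ?thesis
      using p by (intro bexI[of _ "Inr (tail Q (hd p), p)"]) (auto simp: maximal_paths_eq)
  next
    case False
    then show ?thesis
      using no_out v by (intro bexI[of _ "Inr (v, [])"]) (auto simp: maximal_paths_iff)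
  qed
qed

lemma cyclic_successor_star: "cyclic_successor star successor period"
proof -
  interpret star: fin_digraph star by (rule fin_digraph_star)
  show ?thesis
  proof
    fix x assume "x \<in> arcs star"
    then obtain m i where m: "m \<in> maximal_paths Q I" "i \<le> path_length m" and x: "x = closing_arrows m ! i"
      using ex_closing_arrows by blast
    have i': "Suc i mod Suc (path_length m) \<le> path_length m"
      using mod_less_divisor[of "Suc (path_length m)" "Suc i"] by simp
    note simps = x successor_closing_arrows[OF m] period_closing_arrows[OF m]
    show "successor x \<in> arcs star"
      using closing_arrows_subset[OF m(1)] i' unfolding simps
      by (auto intro!: subsetD[OF closing_arrows_subset[OF m(1)]] nth_mem simp del: star_simps)
    show "head star x = tail star (successor x)"
      using head_closing_arrows[OF m] by (simp only: simps)
    show "0 < period x"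
      by (simp add: simps)
    show "period (successor x) = period x"
      using period_closing_arrows[OF m(1) i'] by (simp only: simps)
    have "(i + Suc (path_length m)) mod Suc (path_length m) = i"
      using m(2) unfolding mod_add_self2 by simp
    then show "(successor ^^ period x) x = x"
      using funpow_successor[OF m, of "Suc (path_length m)"] by (simp only: simps)
  next
    fix v assume "v \<in> verts star"
    then show "\<exists>x\<in>arcs star. tail star x = v"
      using ex_star_arrow_from by simp
  qed
qed

sublocale star: cyclic_successor star successor period
  by (rule cyclic_successor_star)

lemma rotate_closing_arrows:
  assumes "m \<in> maximal_paths Q I"
  shows "rotate k (closing_arrows m) = star.full_cycle (closing_arrows m ! (k mod Suc (path_length m)))"
proof (rule nth_equalityI)
  have k: "k mod Suc (path_length m) \<le> path_length m"
    using mod_less_divisor[of "Suc (path_length m)" k] by simp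
  note period = period_closing_arrows[OF assms k]
  then show "length (rotate k (closing_arrows m)) = length (star.full_cycle (closing_arrows m ! (k mod Suc (path_length m))))"
    by simp
  fix i assume "i < length (rotate k (closing_arrows m))"
  then show "rotate k (closing_arrows m) ! i = star.full_cycle (closing_arrows m ! (k mod Suc (path_length m))) ! i"
    using period by (simp add: nth_rotate star.nth_segment funpow_successor[OF assms k] mod_add_left_eq)
qed

text \<open>Rotating by \<open>k\<close> moves the arrow at position \<open>k\<close> modulo the
  length to the front, from where \<open>successor\<close> runs once around; conversely every arrow
  is brought to the front by the rotation by its own position.\<close>

lemma star_cycles_eq: "star_cycles Q I = star.cycles"
proof (intro equalityI subsetI)
  fix C assume "C \<in> star_cycles Q I"
  then obtain m k where m: "m \<in> maximal_paths Q I"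
    and C: "C = (tail star (hd (rotate k (closing_arrows m))), rotate k (closing_arrows m))"
    by (auto simp: star_cycles_def cyclic_permutations_def)
  let ?x = "closing_arrows m ! (k mod Suc (path_length m))"
  have x: "?x \<in> arcs star"
    using mod_less_divisor[of "Suc (path_length m)" k]
    by (intro subsetD[OF closing_arrows_subset[OF m]] nth_mem) simp
  then have "C = (tail star ?x, star.full_cycle ?x)"
    using star.period_pos[OF x] by (simp add: C rotate_closing_arrows[OF m])
  with x show "C \<in> star.cycles"
    unfolding star.cycles_def by blast
next
  fix C assume "C \<in> star.cycles"
  then obtain x where x: "x \<in> arcs star" and C: "C = (tail star x, star.full_cycle x)"
    unfolding star.cycles_def by blast
  obtain m i where m: "m \<in> maximal_paths Q I" "i \<le> path_length m" and eq: "x = closing_arrows m ! i"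
    using ex_closing_arrows[OF x] by blast
  have "rotate i (closing_arrows m) = star.full_cycle x"
    using rotate_closing_arrows[OF m(1), of i] m(2) by (simp add: eq)
  then have "C = (tail star (hd (rotate i (closing_arrows m))), rotate i (closing_arrows m))"
    using star.period_pos[OF x] by (simp add: C)
  with m(1) show "C \<in> star_cycles Q I"
    unfolding star_cycles_def cyclic_permutations_def by blast
qed

lemma star_ideal_eq: "star_ideal Q I = Idl\<^bsub>path_algebra star\<^esub> star.cycle_relations"
  unfolding star_ideal_def star_relations_def star.cycle_relations_def star_cycles_eq ..

text \<open>The cycle closing \<open>m\<close> has one arrow more than \<open>m\<close>, and each of
  its arrows contributes its period minus 1, which is the length of \<open>m\<close>.\<close>

lemma sum_period: "(\<Sum>x\<in>arcs star. period x - 1) = (\<Sum>m\<in>maximal_paths Q I. path_length m * (path_length m + 1))"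
proof -
  let ?A = "SIGMA m:maximal_paths Q I. {..path_length m}" and ?f = "\<lambda>(m, i). closing_arrows m ! i"
  have inj: "inj_on ?f ?A"
    using closing_arrows_inject by (fastforce intro!: inj_onI)
  have "?f ` ?A = arcs star"
  proof (intro equalityI subsetI)
    fix x assume "x \<in> ?f ` ?A"
    then obtain m i where m: "m \<in> maximal_paths Q I" "i \<le> path_length m" and x: "x = closing_arrows m ! i"
      by auto
    then show "x \<in> arcs star"
      unfolding x by (intro subsetD[OF closing_arrows_subset[OF m(1)]] nth_mem) simp
  next
    fix x assume "x \<in> arcs star"
    then obtain m i where "m \<in> maximal_paths Q I" "i \<le> path_length m" "x = closing_arrows m ! i"
      using ex_closing_arrows by blast
    then show "x \<in> ?f ` ?A"
      by (intro image_eqI[of _ _ "(m, i)"]) auto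
  qed
  then have "(\<Sum>x\<in>arcs star. period x - 1) = (\<Sum>(m, i)\<in>?A. period (closing_arrows m ! i) - 1)"
    using sum.reindex[OF inj, of "\<lambda>x. period x - 1"] by (simp add: case_prod_unfold comp_def)
  also have "\<dots> = (\<Sum>m\<in>maximal_paths Q I. \<Sum>i\<le>path_length m. period (closing_arrows m ! i) - 1)"
    using finite_maximal_paths by (subst sum.Sigma) auto
  also have "\<dots> = (\<Sum>m\<in>maximal_paths Q I. path_length m * (path_length m + 1))"
    by (intro sum.cong refl) (simp add: period_closing_arrows)
  finally show ?thesis .
qed

end

theorem proposition3p3:
  fixes Q :: "('v, 'a) pre_digraph"
    and I :: "(('v, 'a) qpath \<Rightarrow>\<^sub>0 'k::field) set"
  assumes "almost_gentle Q I"
    and "indecomposable_ring (quot_algebra Q I)"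
  shows "quot_finite_dim Q I \<and>
    quot_finite_dim (star_quiver Q I) (star_ideal Q I) \<and>
    quot_dim (star_quiver Q I) (star_ideal Q I) =
      2 * card (verts Q) + (\<Sum>m\<in>maximal_paths Q I. path_length m * (path_length m + 1)) \<and>
    quot_dim (star_quiver Q I) (star_ideal Q I) = 2 * quot_dim Q I"
proof -
  have fin: "fin_digraph Q"
    using assms(1) by (simp add: almost_gentle_def)
  interpret almost_gentle_presentation Q I
    using fin assms(1) by (simp add: almost_gentle_presentation_def almost_gentle_presentation_axioms_def)
  have "verts Q \<noteq> {}"
    using fin assms(2) by (rule verts_nonempty_if_indecomposable)
  then have "verts (star_quiver Q I) \<noteq> {}"
    by simp
  \<comment> \<open>\<open>quot_dim_eq\<close> gives twice the dimension of \<open>A\<close> the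
    same right-hand side, which settles the last equation.\<close>
  from star.quot_dim_cycle_relations[OF this, where ?'k = 'k] quot_dim_eq[OF \<open>verts Q \<noteq> {}\<close>]
  show ?thesis
    unfolding star_ideal_eq sum_period by simp
qed

end
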